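(* Let $\Gamma$ be a metrized graph with edge connectivity $\Lambda(\Gamma)=2$. Then there exists a metrized graph $\beta$ such that $\tau(\Gamma)=\tau(\beta)$, $\Lambda(\beta)\ge3$, $\#E(\Gamma)\ge\#E(\beta)$, and $g(\Gamma)=g(\beta)$.
   Context: A metrized graph is a finite connected graph (multiple edges and self-loops allowed) whose edges are identified with closed segments of positive lengths; its vertex set is finite, nonempty and contains all points of valence $\neq2$; $E(\Gamma)$ is its edge set and $g(\Gamma)=\#E(\Gamma)-\#V(\Gamma)+1$ its genus. $\Lambda(\Gamma)$ is the minimum number of edges whose deletion disconnects $\Gamma$. With $r(x,y)$ the effective resistance when each edge is a resistor of resistance equal to its length, $\tau(\Gamma)=\frac14\int_\Gamma(\frac{\partial}{\partial x}r(x,y))^2dx$ (independent of $y$). *)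

theory Defs
  imports "HOL-Analysis.Analysis" "Graph_Theory.Digraph_Component"
begin

text \<open>
  A metrized graph is given by a finite connected multigraph (its vertex and edge set) and a positive
  length for each edge.  Edge \<open>e\<close> stands for the segment \<open>[0, len e]\<close>, parametrised
  from \<open>tail e\<close> to \<open>head e\<close>; this orientation serves only as a parametrisation, and
  \<open>Digraph_Component.connected\<close> is connectedness of the underlying undirected graph (which
  includes having a vertex).  Points in the interior of an edge have valence 2, so all points of
  valence other than 2 are vertices automatically; vertices of valence 2 are allowed.
\<close>

record ('v, 'e) metrized =
  skeleton :: "('v, 'e) pre_digraph"
  len :: "'e \<Rightarrow> real"

definition metrized_graph :: "('v, 'e) metrized \<Rightarrow> bool" where
  "metrized_graph \<Gamma> \<longleftrightarrow>
     fin_digraph (skeleton \<Gamma>) \<and> Digraph_Component.connected (skeleton \<Gamma>) \<and>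
     (\<forall>e\<in>arcs (skeleton \<Gamma>). 0 < len \<Gamma> e)"

abbreviation vertex_set :: "('v, 'e) metrized \<Rightarrow> 'v set" where
  "vertex_set \<Gamma> \<equiv> verts (skeleton \<Gamma>)"

abbreviation edge_set :: "('v, 'e) metrized \<Rightarrow> 'e set" where
  "edge_set \<Gamma> \<equiv> arcs (skeleton \<Gamma>)"

definition genus :: "('v, 'e) metrized \<Rightarrow> int" where
  "genus \<Gamma> = int (card (edge_set \<Gamma>)) - int (card (vertex_set \<Gamma>)) + 1"

text \<open>
  A graph with a single vertex cannot be disconnected by deleting edges; there the infimum is over
  the empty set and the edge connectivity is \<open>\<infinity>\<close>.
\<close>

definition edge_connectivity :: "('v, 'e) metrized \<Rightarrow> enat" where
  "edge_connectivity \<Gamma> =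
     Inf {enat (card F) | F. F \<subseteq> edge_set \<Gamma> \<and>
       \<not> Digraph_Component.connected ((skeleton \<Gamma>)\<lparr>arcs := edge_set \<Gamma> - F\<rparr>)}"


section \<open>Effective resistance\<close>

text \<open>
  For a finite network with resistances \<open>len e\<close>: \<open>\<phi>\<close> is the potential when a unit
  current enters at \<open>a\<close> and leaves at \<open>b\<close> (Kirchhoff's current law, the currents given
  by Ohm's law).  A self-loop occurs in both sums, contributing zero.
\<close>

definition unit_current_potential ::
    "('v, 'e) metrized \<Rightarrow> 'v \<Rightarrow> 'v \<Rightarrow> ('v \<Rightarrow> real) \<Rightarrow> bool" where
  "unit_current_potential N a b \<phi> \<longleftrightarrow>
     (\<forall>v\<in>vertex_set N.
        (\<Sum>e\<in>out_arcs (skeleton N) v. (\<phi> v - \<phi> (head (skeleton N) e)) / len N e) +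
        (\<Sum>e\<in>in_arcs (skeleton N) v. (\<phi> v - \<phi> (tail (skeleton N) e)) / len N e)
        = of_bool (v = a) - of_bool (v = b))"

definition network_resistance :: "('v, 'e) metrized \<Rightarrow> 'v \<Rightarrow> 'v \<Rightarrow> real" where
  "network_resistance N a b =
     (THE R. \<exists>\<phi>. unit_current_potential N a b \<phi> \<and> R = \<phi> a - \<phi> b)"

text \<open>
  The points of \<open>\<Gamma>\<close>: vertices, and interior points of edges given by edge and coordinate.
\<close>

datatype ('v, 'e) point = Vertex 'v | Interior 'e real

definition points :: "('v, 'e) metrized \<Rightarrow> ('v, 'e) point set" where
  "points \<Gamma> = Vertex ` vertex_set \<Gamma> \<union>
     {Interior e t | e t. e \<in> edge_set \<Gamma> \<and> 0 < t \<and> t < len \<Gamma> e}"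

definition edge_point :: "('v, 'e) metrized \<Rightarrow> 'e \<Rightarrow> real \<Rightarrow> ('v, 'e) point" where
  "edge_point \<Gamma> e t =
     (if t \<le> 0 then Vertex (tail (skeleton \<Gamma>) e)
      else if len \<Gamma> e \<le> t then Vertex (head (skeleton \<Gamma>) e)
      else Interior e t)"

text \<open>
  The same space with the points of \<open>S\<close> added to the vertex set: the edge \<open>(e, s, t)\<close>
  of the refinement is the piece of \<open>e\<close> between the consecutive subdivision points
  \<open>s < t\<close>.
\<close>

definition breakpoints :: "('v, 'e) metrized \<Rightarrow> ('v, 'e) point set \<Rightarrow> 'e \<Rightarrow> real set" where
  "breakpoints \<Gamma> S e = {0, len \<Gamma> e} \<union> {t. Interior e t \<in> S}"

definition refine ::
    "('v, 'e) metrized \<Rightarrow> ('v, 'e) point set \<Rightarrow> (('v, 'e) point, 'e \<times> real \<times> real) metrized" where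
  "refine \<Gamma> S =
     \<lparr> skeleton =
         \<lparr> verts = Vertex ` vertex_set \<Gamma> \<union> S,
           arcs = {(e, s, t). e \<in> edge_set \<Gamma> \<and> s \<in> breakpoints \<Gamma> S e \<and> t \<in> breakpoints \<Gamma> S e \<and>
                     s < t \<and> breakpoints \<Gamma> S e \<inter> {s<..<t} = {}},
           tail = (\<lambda>(e, s, t). edge_point \<Gamma> e s),
           head = (\<lambda>(e, s, t). edge_point \<Gamma> e t) \<rparr>,
       len = (\<lambda>(e, s, t). t - s) \<rparr>"

definition resistance ::
    "('v, 'e) metrized \<Rightarrow> ('v, 'e) point \<Rightarrow> ('v, 'e) point \<Rightarrow> real" where
  "resistance \<Gamma> x y = network_resistance (refine \<Gamma> {x, y}) x y"


section \<open>The tau constant\<close>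

text \<open>
  The integral over \<open>\<Gamma>\<close> is the sum over the edges of the integrals in the arc length
  coordinate.  The derivative may fail to exist at the endpoints of an edge and at \<open>y\<close>; these
  finitely many points do not affect the integral.
\<close>

definition tau_at :: "('v, 'e) metrized \<Rightarrow> ('v, 'e) point \<Rightarrow> real" where
  "tau_at \<Gamma> y =
     1 / 4 * (\<Sum>e\<in>edge_set \<Gamma>.
       integral {0..len \<Gamma> e} (\<lambda>t. (deriv (\<lambda>s. resistance \<Gamma> (edge_point \<Gamma> e s) y) t)\<^sup>2))"

text \<open>The value does not depend on the base point, so an arbitrary one is chosen.\<close>

definition tau :: "('v, 'e) metrized \<Rightarrow> real" where
  "tau \<Gamma> = tau_at \<Gamma> (SOME y. y \<in> points \<Gamma>)"

end

theory Submission
  imports Defs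
begin

text \<open>
  As long as some cut consists of exactly two edges \<open>e1\<close>, \<open>e2\<close>, contract
  \<open>e1\<close> and add its length to \<open>e2\<close>.  This keeps the genus, loses an edge and creates
  no smaller cuts, so it remains to see that \<open>\<tau>\<close> is unchanged.  On an edge from \<open>a\<close>
  to \<open>b\<close> of length \<open>L\<close> the function \<open>r(x, y)\<close> is piecewise quadratic in
  \<open>x\<close>, and integrating gives
  \<open>4 \<tau> = (\<Sum>e. (L - r(a, b))\<^sup>2 / (3 L) + (r(b, p) - r(a, p))\<^sup>2 / L)\<close>
  for every vertex \<open>p\<close>.  Take for \<open>p\<close> an end of \<open>e1\<close>.  Resistances between
  vertices on the same side of the cut are not affected by the contraction, and the remaining terms
  depend only on the two lengths and the resistances \<open>x\<close>, \<open>y\<close> of the two sides.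
\<close>

section \<open>Cuts and connectedness\<close>

text \<open>Electrically, \<open>\<Gamma>\<close> is a circle of four arcs: \<open>e1\<close>, the
  side \<open>S\<close> with resistance x, \<open>e2\<close>, and the other side with resistance y.
  The resistance between the ends of an arc z is z (D - z) / D, where D = L1 + L2 + x + y is the
  circumference. Contraction merely joins two arcs, so D stays the same. Neither side is built as a
  graph of its own. All three numbers are read off from one potential, that of a unit current
  between the ends of \<open>e1\<close>: if c is the part returning through \<open>e2\<close>, then
  D = L1 / c. The absence of bridges enters here, because it makes c nonzero. The obstacle is the
  summand of the formula that refers to p, since resistances across the cut do change. With p =
  \<open>a1\<close>, contraction replaces p by \<open>b1\<close> as seen from \<open>S\<close> and
  changes nothing as seen from the other side. The price is the term 4 L1 x (L2 + y) / D^2.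
  Potentials are handled in weak form throughout, so that superposition, reciprocity and restriction
  to one side become choices of a test function.\<close>

definition cut_arcs :: "('v, 'e) pre_digraph \<Rightarrow> 'v set \<Rightarrow> 'e set" where
  "cut_arcs G S = {e \<in> arcs G. (tail G e \<in> S) \<noteq> (head G e \<in> S)}"

text \<open>The set of vertices reachable from \<open>u\<close> is crossed by no arc, and conversely
  reachability cannot leave an uncrossed set. From here on connectedness is used only through vertex
  sets, never through walks.\<close>

lemma connected_iff_cut:
  assumes "wf_digraph G"
  shows "Digraph_Component.connected G \<longleftrightarrow>
    verts G \<noteq> {} \<and> (\<forall>S\<subseteq>verts G. S \<noteq> {} \<longrightarrow> S \<noteq> verts G \<longrightarrow> cut_arcs G S \<noteq> {})"
proof -
  interpret wf_digraph G by fact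
  interpret S: pair_wf_digraph "mk_symmetric G" by (rule wellformed_mk_symmetric)
  let ?r = "\<lambda>u v. u \<rightarrow>\<^sup>*\<^bsub>mk_symmetric G\<^esub> v"
  have closed: "v \<in> S" if "?r u v" "u \<in> S" "cut_arcs G S = {}" for u v S
    using that(1,2)
  proof (induction rule: S.reachable_induct)
    case (step x y)
    then show ?case
      using that(3) by (auto simp: cut_arcs_def parcs_mk_symmetric)
  qed auto
  have "cut_arcs G S \<noteq> {}"
    if conn: "\<forall>u\<in>verts G. \<forall>v\<in>verts G. ?r u v"
      and S: "S \<subseteq> verts G" "S \<noteq> {}" "S \<noteq> verts G" for S
  proof
    assume "cut_arcs G S = {}"
    moreover obtain u v where "u \<in> S" "v \<in> verts G" "v \<notin> S"
      using S by blast
    ultimately show False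
      using conn S closed[of u v S] by blast
  qed
  moreover have "?r u v"
    if cuts: "\<forall>S\<subseteq>verts G. S \<noteq> {} \<longrightarrow> S \<noteq> verts G \<longrightarrow> cut_arcs G S \<noteq> {}"
      and uv: "u \<in> verts G" "v \<in> verts G" for u v
  proof (rule ccontr)
    assume "\<not> ?r u v"
    define T where "T = {w \<in> verts G. ?r u w}"
    have "u \<in> T" "v \<notin> T"
      using uv \<open>\<not> ?r u v\<close> by (auto simp: T_def)
    moreover have "cut_arcs G T = {}"
    proof (rule ccontr)
      assume "cut_arcs G T \<noteq> {}"
      then obtain e where e: "e \<in> arcs G" "(tail G e \<in> T) \<noteq> (head G e \<in> T)"
        by (auto simp: cut_arcs_def)
      then have "(tail G e, head G e) \<in> parcs (mk_symmetric G)"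
        "(head G e, tail G e) \<in> parcs (mk_symmetric G)"
        by (auto simp: parcs_mk_symmetric)
      then show False
        using e S.reachable_adj_trans[of u "tail G e" "head G e"]
          S.reachable_adj_trans[of u "head G e" "tail G e"]
        by (auto simp: T_def)
    qed
    ultimately show False
      using cuts uv by (metis (no_types, lifting) T_def empty_iff mem_Collect_eq subsetI)
  qed
  ultimately show ?thesis
    by (auto simp: Digraph_Component.connected_def strongly_connected_def)
qed

section \<open>Positive definite systems\<close>

text \<open>Symmetric elimination of one unknown at a time: positivity gives a positive pivot
  \<open>M v v\<close> and is inherited by the reduced system.\<close>

lemma positive_definite_solvable:
  fixes M :: "'a \<Rightarrow> 'a \<Rightarrow> real"
  assumes "finite V" and sym: "\<And>i j. M i j = M j i"
    and pos: "\<And>x. \<exists>i\<in>V. x i \<noteq> 0 \<Longrightarrow> 0 < (\<Sum>i\<in>V. \<Sum>j\<in>V. M i j * x i * x j)"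
  shows "\<exists>x. \<forall>i\<in>V. (\<Sum>j\<in>V. M i j * x j) = b i"
  using assms
proof (induction V arbitrary: M b rule: finite_induct)
  case (insert v V)
  note fin = insert.hyps(1) and v = insert.hyps(2)
  note sym = insert.prems(1) and pos = insert.prems(2)
  have split: "(\<Sum>i\<in>insert v V. \<Sum>j\<in>insert v V. M i j * x i * x j) =
      M v v * x v * x v + 2 * x v * (\<Sum>j\<in>V. M v j * x j) + (\<Sum>i\<in>V. \<Sum>j\<in>V. M i j * x i * x j)" for x
  proof -
    have "(\<Sum>i\<in>V. M i v * x i * x v) = x v * (\<Sum>j\<in>V. M v j * x j)"
      unfolding sum_distrib_left by (rule sum.cong) (use sym in auto)
    moreover have "(\<Sum>j\<in>V. M v j * x v * x j) = x v * (\<Sum>j\<in>V. M v j * x j)"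
      unfolding sum_distrib_left by (rule sum.cong) auto
    ultimately show ?thesis
      using fin v by (simp add: sum.distrib)
  qed
  have Mvv: "0 < M v v"
  proof -
    have "0 < (\<Sum>i\<in>insert v V. \<Sum>j\<in>insert v V. M i j * of_bool (i = v) * of_bool (j = v))"
      by (rule pos) auto
    also have "\<dots> = M v v"
    proof -
      have "(\<Sum>j\<in>V. M v j * of_bool (j = v)) = 0"
        "(\<Sum>i\<in>V. \<Sum>j\<in>V. M i j * of_bool (i = v) * of_bool (j = v)) = 0"
        using v by (auto intro!: sum.neutral)
      then show ?thesis by (simp add: split)
    qed
    finally show ?thesis .
  qed
  \<comment> \<open>The Schur complement of the pivot.\<close>
  define N where "N i j = M i j - M v i * M v j / M v v" for i j
  have "\<exists>x. \<forall>i\<in>V. (\<Sum>j\<in>V. N i j * x j) = b i - M v i * b v / M v v"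
  proof (rule insert.IH)
    show "N i j = N j i" for i j
      by (simp add: N_def sym[of i j])
  next
    fix x :: "'a \<Rightarrow> real"
    assume x: "\<exists>i\<in>V. x i \<noteq> 0"
    define s where "s = (\<Sum>j\<in>V. M v j * x j)"
    \<comment> \<open>This value at \<open>v\<close> minimizes the form of \<open>M\<close> over all
      extensions of \<open>x\<close>, and the minimum is the form of \<open>N\<close> at
      \<open>x\<close>.\<close>
    define y where "y = x(v := - s / M v v)"
    have y: "y v = - s / M v v" "\<And>i. i \<in> V \<Longrightarrow> y i = x i"
      using v by (auto simp: y_def)
    have "0 < (\<Sum>i\<in>insert v V. \<Sum>j\<in>insert v V. M i j * y i * y j)"
      using x y by (intro pos) auto
    also have "\<dots> = M v v * y v * y v + 2 * y v * s + (\<Sum>i\<in>V. \<Sum>j\<in>V. M i j * x i * x j)"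
      unfolding split s_def by (simp add: y(2) cong: sum.cong)
    also have "M v v * y v * y v + 2 * y v * s = - (s * s / M v v)"
      unfolding y(1) using Mvv by (simp add: field_simps)
    also have "s * s / M v v = (\<Sum>i\<in>V. \<Sum>j\<in>V. M v i * M v j / M v v * x i * x j)"
      by (simp add: s_def sum_product sum_divide_distrib field_simps)
    also have "- \<dots> + (\<Sum>i\<in>V. \<Sum>j\<in>V. M i j * x i * x j) = (\<Sum>i\<in>V. \<Sum>j\<in>V. N i j * x i * x j)"
      by (simp add: N_def sum_subtractf[symmetric] left_diff_distrib)
    finally show "0 < (\<Sum>i\<in>V. \<Sum>j\<in>V. N i j * x i * x j)" .
  qed
  then obtain x where x: "\<And>i. i \<in> V \<Longrightarrow> (\<Sum>j\<in>V. N i j * x j) = b i - M v i * b v / M v v"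
    by blast
  define s where "s = (\<Sum>j\<in>V. M v j * x j)"
  \<comment> \<open>Back substitution: row \<open>v\<close> solved for the eliminated
    unknown.\<close>
  define y where "y = x(v := (b v - s) / M v v)"
  have y: "y v = (b v - s) / M v v" "\<And>i. i \<in> V \<Longrightarrow> y i = x i"
    using v by (auto simp: y_def)
  have ys: "(\<Sum>j\<in>V. M i j * y j) = (\<Sum>j\<in>V. M i j * x j)" for i
    by (intro sum.cong) (simp_all add: y(2))
  have "(\<Sum>j\<in>insert v V. M i j * y j) = b i" if "i \<in> insert v V" for i
  proof (cases "i = v")
    case True
    then show ?thesis
      using fin v Mvv ys by (simp add: y(1) s_def)
  next
    case False
    then have i: "i \<in> V" using that by simp
    have "(\<Sum>j\<in>V. N i j * x j) = (\<Sum>j\<in>V. M i j * x j) - M v i * s / M v v"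
      by (simp add: N_def s_def algebra_simps sum_subtractf sum_distrib_left sum_divide_distrib)
    then have "(\<Sum>j\<in>V. M i j * x j) = b i - M v i * b v / M v v + M v i * s / M v v"
      using x[OF i] by simp
    then show ?thesis
      using fin v Mvv sym[of i v] ys[of i] by (simp add: y(1) diff_divide_distrib right_diff_distrib)
  qed
  then show ?case by blast
qed auto

section \<open>Dirichlet form and potentials\<close>

definition energy :: "('v, 'e) metrized \<Rightarrow> ('v \<Rightarrow> real) \<Rightarrow> ('v \<Rightarrow> real) \<Rightarrow> real" where
  "energy N g f = (\<Sum>e\<in>edge_set N.
     (g (head (skeleton N) e) - g (tail (skeleton N) e)) *
     (f (head (skeleton N) e) - f (tail (skeleton N) e)) / len N e)"

definition laplacian :: "('v, 'e) metrized \<Rightarrow> ('v \<Rightarrow> real) \<Rightarrow> 'v \<Rightarrow> real" where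
  "laplacian N f v =
     (\<Sum>e\<in>out_arcs (skeleton N) v. (f v - f (head (skeleton N) e)) / len N e) +
     (\<Sum>e\<in>in_arcs (skeleton N) v. (f v - f (tail (skeleton N) e)) / len N e)"

text \<open>The weak form of \<^const>\<open>unit_current_potential\<close>, by Green's identity.\<close>

definition potential :: "('v, 'e) metrized \<Rightarrow> 'v \<Rightarrow> 'v \<Rightarrow> ('v \<Rightarrow> real) \<Rightarrow> bool" where
  "potential N a b f \<longleftrightarrow> (\<forall>g. energy N g f = g a - g b)"

lemma energy_commute: "energy N g f = energy N f g"
  by (simp add: energy_def mult.commute)

lemma energy_add: "energy N g (\<lambda>v. f v + f' v) = energy N g f + energy N g f'"
  unfolding energy_def sum.distrib[symmetric]
  by (intro sum.cong) (simp_all add: add_divide_distrib[symmetric] algebra_simps)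

lemma energy_scale: "energy N g (\<lambda>v. c * f v) = c * energy N g f"
  by (simp add: energy_def sum_distrib_left algebra_simps diff_divide_distrib)

lemma energy_cong:
  assumes "wf_digraph (skeleton N)" "\<And>v. v \<in> vertex_set N \<Longrightarrow> f v = f' v"
  shows "energy N g f = energy N g f'"
  unfolding energy_def using assms
  by (intro sum.cong) (auto simp: wf_digraph.tail_in_verts wf_digraph.head_in_verts)

lemma green_identity:
  assumes "fin_digraph (skeleton N)"
  shows "(\<Sum>v\<in>vertex_set N. g v * laplacian N f v) = energy N g f"
proof -
  interpret fin_digraph "skeleton N" by fact
  let ?t = "tail (skeleton N)" and ?h = "head (skeleton N)"
  have out: "(\<Sum>v\<in>vertex_set N. g v * (\<Sum>e\<in>out_arcs (skeleton N) v. (f v - f (?h e)) / len N e)) =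
      (\<Sum>e\<in>edge_set N. g (?t e) * ((f (?t e) - f (?h e)) / len N e))"
  proof -
    have "(\<Sum>v\<in>vertex_set N. g v * (\<Sum>e\<in>out_arcs (skeleton N) v. (f v - f (?h e)) / len N e)) =
        (\<Sum>v\<in>vertex_set N. \<Sum>e | e \<in> edge_set N \<and> ?t e = v. g (?t e) * ((f (?t e) - f (?h e)) / len N e))"
      unfolding sum_distrib_left out_arcs_def by (intro sum.cong) auto
    also have "\<dots> = (\<Sum>e\<in>edge_set N. g (?t e) * ((f (?t e) - f (?h e)) / len N e))"
      by (rule sum.group) auto
    finally show ?thesis .
  qed
  have inn: "(\<Sum>v\<in>vertex_set N. g v * (\<Sum>e\<in>in_arcs (skeleton N) v. (f v - f (?t e)) / len N e)) =
      (\<Sum>e\<in>edge_set N. g (?h e) * ((f (?h e) - f (?t e)) / len N e))"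
  proof -
    have "(\<Sum>v\<in>vertex_set N. g v * (\<Sum>e\<in>in_arcs (skeleton N) v. (f v - f (?t e)) / len N e)) =
        (\<Sum>v\<in>vertex_set N. \<Sum>e | e \<in> edge_set N \<and> ?h e = v. g (?h e) * ((f (?h e) - f (?t e)) / len N e))"
      unfolding sum_distrib_left in_arcs_def by (intro sum.cong) auto
    also have "\<dots> = (\<Sum>e\<in>edge_set N. g (?h e) * ((f (?h e) - f (?t e)) / len N e))"
      by (rule sum.group) auto
    finally show ?thesis .
  qed
  show ?thesis
    unfolding laplacian_def distrib_left sum.distrib out inn energy_def
    unfolding sum.distrib[symmetric]
    by (intro sum.cong) (auto simp: add_divide_distrib[symmetric] algebra_simps)
qed

lemma unit_current_potential_iff_potential:
  assumes fin: "fin_digraph (skeleton N)" and ab: "a \<in> vertex_set N" "b \<in> vertex_set N"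
  shows "unit_current_potential N a b f \<longleftrightarrow> potential N a b f"
proof
  interpret fin_digraph "skeleton N" by fact
  assume "unit_current_potential N a b f"
  then have "laplacian N f v = of_bool (v = a) - of_bool (v = b)" if "v \<in> vertex_set N" for v
    using that by (simp add: unit_current_potential_def laplacian_def)
  then have "energy N g f = (\<Sum>v\<in>vertex_set N. g v * (of_bool (v = a) - of_bool (v = b)))" for g
    unfolding green_identity[OF fin, symmetric] by (intro sum.cong) auto
  then show "potential N a b f"
    using ab by (simp add: potential_def right_diff_distrib sum_subtractf)
next
  interpret fin_digraph "skeleton N" by fact
  assume f: "potential N a b f"
  have "laplacian N f v = of_bool (v = a) - of_bool (v = b)" if "v \<in> vertex_set N" for v
  proof -
    \<comment> \<open>Testing against the indicator of \<open>v\<close> recovers the pointwise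
      equation from the weak one.\<close>
    have "laplacian N f v = (\<Sum>w\<in>vertex_set N. of_bool (w = v) * laplacian N f w)"
      using that by simp
    also have "\<dots> = of_bool (a = v) - of_bool (b = v)"
      using f by (simp add: green_identity[OF fin] potential_def)
    finally show ?thesis by (simp add: eq_commute)
  qed
  then show "unit_current_potential N a b f"
    by (simp add: unit_current_potential_def laplacian_def)
qed

lemma potential_add: "potential N a b f \<Longrightarrow> potential N b c g \<Longrightarrow> potential N a c (\<lambda>v. f v + g v)"
  by (simp add: potential_def energy_add)

lemma potential_minus: "potential N a b f \<Longrightarrow> potential N b a (\<lambda>v. - f v)"
  using energy_scale[of N _ "-1" f] by (simp add: potential_def)

text \<open>Both differences equal the energy of the pair \<open>f\<close>, \<open>g\<close>. With
  equal poles this also shows that the voltage between them does not depend on the chosen potential,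
  which settles the \<open>THE\<close> in \<open>network_resistance\<close>.\<close>

lemma reciprocity:
  "potential N a b f \<Longrightarrow> potential N c d g \<Longrightarrow> f c - f d = g a - g b"
  unfolding potential_def by (metis energy_commute)

lemma network_resistance_eq:
  assumes "fin_digraph (skeleton N)" "a \<in> vertex_set N" "b \<in> vertex_set N" "potential N a b f"
  shows "network_resistance N a b = f a - f b"
  unfolding network_resistance_def unit_current_potential_iff_potential[OF assms(1-3)]
  using assms(4) by (auto intro!: the_equality dest: reciprocity)

text \<open>Otherwise some edge leaves the level set of \<open>f\<close> through \<open>u\<close>,
  and that edge has positive energy.\<close>

lemma energy_zero_const:
  assumes N: "metrized_graph N" and 0: "energy N f f = 0" and uv: "u \<in> vertex_set N" "v \<in> vertex_set N"
  shows "f u = f v"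
proof (rule ccontr)
  assume ne: "f u \<noteq> f v"
  interpret fin_digraph "skeleton N" using N by (simp add: metrized_graph_def)
  define S where "S = {w \<in> vertex_set N. f w = f u}"
  have "S \<subseteq> vertex_set N" "S \<noteq> {}" "S \<noteq> vertex_set N"
    using uv ne by (auto simp: S_def set_eq_iff intro: exI[of _ v])
  then have "cut_arcs (skeleton N) S \<noteq> {}"
    using N connected_iff_cut[OF wf_digraph] by (simp add: metrized_graph_def)
  then obtain e where e: "e \<in> edge_set N" "f (head (skeleton N) e) \<noteq> f (tail (skeleton N) e)"
    unfolding cut_arcs_def S_def by fastforce
  have pos: "0 < len N e" if "e \<in> edge_set N" for e
    using N that by (simp add: metrized_graph_def)
  have "\<forall>e\<in>edge_set N. (f (head (skeleton N) e) - f (tail (skeleton N) e)) *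
     (f (head (skeleton N) e) - f (tail (skeleton N) e)) / len N e = 0"
    using 0 pos unfolding energy_def
    by (subst (asm) sum_nonneg_eq_0_iff) (auto intro!: divide_nonneg_pos)
  then show False
    using e pos[OF e(1)] by auto
qed

lemma potential_exists:
  assumes N: "metrized_graph N" and ab: "a \<in> vertex_set N" "b \<in> vertex_set N"
  shows "\<exists>f. potential N a b f"
proof -
  interpret fin_digraph "skeleton N" using N by (simp add: metrized_graph_def)
  have pos: "0 < len N e" if "e \<in> edge_set N" for e
    using N that by (simp add: metrized_graph_def)
  let ?V = "vertex_set N"
  define ind where "ind i = (\<lambda>v. of_bool (v = i) :: real)" for i :: 'a
  \<comment> \<open>The energy form is only semidefinite, as it vanishes on constants; the rank-one
    term at \<open>b\<close> makes it definite.\<close>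
  define M where "M i j = energy N (ind i) (ind j) + ind b i * ind b j" for i j
  have expand: "energy N g (\<lambda>v. \<Sum>j\<in>?V. x j * ind j v) = (\<Sum>j\<in>?V. x j * energy N g (ind j))" for g x
  proof -
    have "energy N g (\<lambda>v. \<Sum>j\<in>A. x j * ind j v) = (\<Sum>j\<in>A. x j * energy N g (ind j))"
      if "finite A" for A
      using that
    proof (induction A)
      case empty
      show ?case by (simp add: energy_def)
    next
      case (insert j A)
      then show ?case by (simp add: energy_add energy_scale)
    qed
    then show ?thesis by simp
  qed
  have x_eq: "(\<Sum>j\<in>?V. x j * ind j v) = x v" if "v \<in> ?V" for v and x :: "'a \<Rightarrow> real"
    using that by (simp add: ind_def)
  have energy_x_eq: "energy N y (\<lambda>v. \<Sum>j\<in>?V. x j * ind j v) = energy N y x" for x y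
    by (rule energy_cong[OF wf_digraph x_eq])
  have pick: "(\<Sum>i\<in>?V. y i * (ind b i * c)) = y b * c" for y c
    using ab(2) by (simp add: ind_def mult.left_commute[of _ "of_bool _"])
  have energy_M: "(\<Sum>j\<in>?V. M i j * x j) = energy N (ind i) x + ind b i * x b" for i x
  proof -
    have "(\<Sum>j\<in>?V. M i j * x j) =
        (\<Sum>j\<in>?V. x j * energy N (ind i) (ind j)) + ind b i * (\<Sum>j\<in>?V. x j * ind j b)"
      by (simp add: M_def algebra_simps sum.distrib sum_distrib_left ind_def eq_commute)
    also have "\<dots> = energy N (ind i) x + ind b i * x b"
      unfolding expand[symmetric] x_eq[OF ab(2)]
      by (simp add: energy_x_eq)
    finally show ?thesis .
  qed
  have energy_expand: "(\<Sum>i\<in>?V. y i * energy N (ind i) x) = energy N y x" for x y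
    using expand[of x y] unfolding energy_x_eq by (simp add: energy_commute[of N x])
  have "\<exists>x. \<forall>i\<in>?V. (\<Sum>j\<in>?V. M i j * x j) = ind a i - ind b i"
  proof (rule positive_definite_solvable)
    show "M i j = M j i" for i j
      by (simp add: M_def energy_commute[of N "ind i"])
  next
    fix x :: "'a \<Rightarrow> real"
    assume x: "\<exists>i\<in>?V. x i \<noteq> 0"
    have "(\<Sum>i\<in>?V. \<Sum>j\<in>?V. M i j * x i * x j) = (\<Sum>i\<in>?V. x i * (\<Sum>j\<in>?V. M i j * x j))"
      by (simp add: sum_distrib_left mult_ac)
    also have "\<dots> = energy N x x + x b * x b"
      unfolding energy_M distrib_left sum.distrib energy_expand pick ..
    also have "\<dots> > 0"
    proof -
      have "0 \<le> energy N x x"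
        unfolding energy_def using pos by (auto intro!: sum_nonneg divide_nonneg_pos)
      moreover have "energy N x x \<noteq> 0 \<or> x b \<noteq> 0"
        using x energy_zero_const[OF N, of x] ab by metis
      ultimately show ?thesis
        by (cases "x b = 0") (auto intro: add_nonneg_pos simp flip: power2_eq_square)
    qed
    finally show "0 < (\<Sum>i\<in>?V. \<Sum>j\<in>?V. M i j * x i * x j)" .
  qed simp
  then obtain x where x: "\<And>i. i \<in> ?V \<Longrightarrow> energy N (ind i) x + ind b i * x b = ind a i - ind b i"
    by (auto simp: energy_M)
  have weak: "energy N y x + y b * x b = y a - y b" for y
  proof -
    have "(\<Sum>i\<in>?V. y i * (energy N (ind i) x + ind b i * x b)) = (\<Sum>i\<in>?V. y i * (ind a i - ind b i))"
      using x by simp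
    then show ?thesis
      unfolding distrib_left right_diff_distrib sum.distrib sum_subtractf energy_expand pick
      using ab by (simp add: ind_def)
  qed
  \<comment> \<open>Constants have no energy and equal values at \<open>a\<close> and
    \<open>b\<close>, so this test function shows that the added term vanishes at the
    solution.\<close>
  from weak[of "\<lambda>_. 1"] have "x b = 0"
    by (simp add: energy_def)
  then show ?thesis
    using weak by (auto simp: potential_def)
qed

section \<open>Sums over consecutive elements\<close>

definition consecutive :: "'a::linorder set \<Rightarrow> ('a \<times> 'a) set" where
  "consecutive B = {(s, t). s \<in> B \<and> t \<in> B \<and> s < t \<and> B \<inter> {s<..<t} = {}}"

lemma finite_consecutive: "finite B \<Longrightarrow> finite (consecutive B)"
  by (rule finite_subset[of _ "B \<times> B"]) (auto simp: consecutive_def)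

lemma consecutive_insert_max:
  assumes "finite A" "A \<noteq> {}" "\<And>a. a \<in> A \<Longrightarrow> a < b"
  shows "consecutive (insert b A) = insert (Max A, b) (consecutive A)"
proof -
  have Max: "Max A \<in> A" "\<And>a. a \<in> A \<Longrightarrow> a \<le> Max A"
    using assms by auto
  have "(s, t) \<in> consecutive (insert b A) \<longleftrightarrow> (s, t) \<in> insert (Max A, b) (consecutive A)" for s t
  proof (cases "t = b")
    case True
    have "(s, b) \<in> consecutive (insert b A) \<longleftrightarrow> s \<in> A \<and> A \<inter> {s<..<b} = {}"
      using assms(3) by (auto simp: consecutive_def)
    also have "\<dots> \<longleftrightarrow> s = Max A"
      using Max assms(3) by (force simp: not_less[symmetric])
    finally show ?thesis
      using True assms(3) by (auto simp: consecutive_def)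
  next
    case False
    then show ?thesis
      using assms(3) by (auto simp: consecutive_def dest: less_trans)
  qed
  then show ?thesis by auto
qed

text \<open>Telescoping stopped at \<open>u\<close>. The truncated form also covers the function
  \<open>min _ u\<close>, whose slope is 1 up to \<open>u\<close> and 0 beyond.\<close>

lemma sum_consecutive_le:
  fixes \<gamma> :: "'a::linorder \<Rightarrow> real"
  assumes "finite B" "u \<in> B"
  shows "(\<Sum>(s, t)\<in>consecutive B. of_bool (t \<le> u) * (\<gamma> t - \<gamma> s)) = \<gamma> u - \<gamma> (Min B)"
  using assms
proof (induction B arbitrary: u rule: finite_linorder_max_induct)
  case (insert b A)
  show ?case
  proof (cases "A = {}")
    case True
    then show ?thesis
      using insert by (auto simp: consecutive_def intro!: sum.neutral)
  next
    case False
    have less: "a < b" if "a \<in> A" for a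
      using insert.hyps(2) that by blast
    have Max: "Max A \<in> A" and Min: "Min (insert b A) = Min A"
      using insert.hyps(1) less False by (auto simp: min_absorb2 less_imp_le)
    have "(Max A, b) \<notin> consecutive A"
      using less by (auto simp: consecutive_def)
    then have eq: "(\<Sum>(s, t)\<in>consecutive (insert b A). of_bool (t \<le> u) * (\<gamma> t - \<gamma> s)) =
        of_bool (b \<le> u) * (\<gamma> b - \<gamma> (Max A)) +
        (\<Sum>(s, t)\<in>consecutive A. of_bool (t \<le> u) * (\<gamma> t - \<gamma> s))"
      using consecutive_insert_max[OF insert.hyps(1) False less] finite_consecutive[OF insert.hyps(1)]
      by simp
    show ?thesis
    proof (cases "u = b")
      case True
      \<comment> \<open>The induction hypothesis needs its bound in \<open>A\<close>, so
        \<open>b\<close> is replaced by \<open>Max A\<close>, which admits the same pairs.\<close>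
      have "(\<Sum>(s, t)\<in>consecutive A. of_bool (t \<le> b) * (\<gamma> t - \<gamma> s)) =
          (\<Sum>(s, t)\<in>consecutive A. of_bool (t \<le> Max A) * (\<gamma> t - \<gamma> s))"
        using insert.hyps(1) less by (intro sum.cong) (auto simp: consecutive_def less_imp_le)
      then show ?thesis
        using eq True Min insert.IH[OF Max] by simp
    next
      case False
      then have "u \<in> A" using insert.prems by simp
      then show ?thesis
        using eq Min insert.IH[of u] less[of u] by (simp add: not_le)
    qed
  qed
qed simp

lemma sum_consecutive:
  fixes \<gamma> :: "'a::linorder \<Rightarrow> real"
  assumes "finite B" "B \<noteq> {}"
  shows "(\<Sum>(s, t)\<in>consecutive B. \<gamma> t - \<gamma> s) = \<gamma> (Max B) - \<gamma> (Min B)"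
proof -
  have "(\<Sum>(s, t)\<in>consecutive B. \<gamma> t - \<gamma> s) =
      (\<Sum>(s, t)\<in>consecutive B. of_bool (t \<le> Max B) * (\<gamma> t - \<gamma> s))"
    using assms(1) by (intro sum.cong) (auto simp: consecutive_def)
  then show ?thesis
    using sum_consecutive_le[of B "Max B" \<gamma>] assms by simp
qed

text \<open>Since \<open>u\<close> is a breakpoint, no pair straddles it, and the difference
  quotient of \<open>min _ u\<close> on each pair is exactly 0 or 1.\<close>

lemma sum_consecutive_min:
  fixes \<gamma> :: "real \<Rightarrow> real"
  assumes "finite B" "u \<in> B"
  shows "(\<Sum>(s, t)\<in>consecutive B. (\<gamma> t - \<gamma> s) * (min t u - min s u) / (t - s)) = \<gamma> u - \<gamma> (Min B)"
proof -
  have "(\<gamma> t - \<gamma> s) * (min t u - min s u) / (t - s) = of_bool (t \<le> u) * (\<gamma> t - \<gamma> s)"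
    if "(s, t) \<in> consecutive B" for s t
  proof -
    have "s < t" "u \<notin> {s<..<t}"
      using that assms(2) by (auto simp: consecutive_def)
    then show ?thesis by (auto simp: min_def)
  qed
  then show ?thesis
    using sum_consecutive_le[OF assms, of \<gamma>] by (simp add: case_prod_beta' cong: sum.cong)
qed

section \<open>The resistance function in terms of a Green function\<close>

definition lin :: "('v, 'e) metrized \<Rightarrow> ('v \<Rightarrow> real) \<Rightarrow> ('v, 'e) point \<Rightarrow> real" where
  "lin \<Gamma> f x = (case x of Vertex v \<Rightarrow> f v
     | Interior e t \<Rightarrow> f (tail (skeleton \<Gamma>) e) +
         t / len \<Gamma> e * (f (head (skeleton \<Gamma>) e) - f (tail (skeleton \<Gamma>) e)))"

text \<open>The Green function of a single edge with grounded endpoints.\<close>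

definition bump :: "('v, 'e) metrized \<Rightarrow> ('v, 'e) point \<Rightarrow> 'e \<Rightarrow> real \<Rightarrow> real" where
  "bump \<Gamma> x e t = (case x of Vertex v \<Rightarrow> 0
     | Interior e' u \<Rightarrow> if e' = e then min t u - t * u / len \<Gamma> e else 0)"

text \<open>\<open>G x v\<close> is the voltage function grounded at \<open>p\<close>. The ground is
  left free because the formula for tau will be applied at a chosen vertex.\<close>

locale green_function =
  fixes \<Gamma> :: "('v, 'e) metrized" and p :: 'v and G :: "'v \<Rightarrow> 'v \<Rightarrow> real"
  assumes metrized_graph: "metrized_graph \<Gamma>" and p: "p \<in> vertex_set \<Gamma>"
    and potential_G: "\<And>x. x \<in> vertex_set \<Gamma> \<Longrightarrow> potential \<Gamma> x p (G x)"
    and G_p: "\<And>x. x \<in> vertex_set \<Gamma> \<Longrightarrow> G x p = 0"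
begin

sublocale fin_digraph "skeleton \<Gamma>"
  using metrized_graph by (simp add: metrized_graph_def)

abbreviation "src \<equiv> tail (skeleton \<Gamma>)"
abbreviation "tgt \<equiv> head (skeleton \<Gamma>)"
abbreviation "E \<equiv> edge_set \<Gamma>"

lemma len_pos: "e \<in> E \<Longrightarrow> 0 < len \<Gamma> e"
  using metrized_graph by (simp add: metrized_graph_def)

lemma G_sym: "x \<in> vertex_set \<Gamma> \<Longrightarrow> y \<in> vertex_set \<Gamma> \<Longrightarrow> G x y = G y x"
  using reciprocity[OF potential_G potential_G, of x y] by (simp add: G_p)

lemma network_resistance_G:
  assumes "x \<in> vertex_set \<Gamma>" "y \<in> vertex_set \<Gamma>"
  shows "network_resistance \<Gamma> x y = G x x + G y y - 2 * G x y"
proof -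
  have "potential \<Gamma> x y (\<lambda>v. G x v + - G y v)"
    using assms by (intro potential_add[OF potential_G potential_minus[OF potential_G]])
  from network_resistance_eq[OF fin_digraph assms this] show ?thesis
    using G_sym[OF assms] by simp
qed

text \<open>
  \<open>K x\<close> is the potential at the vertices of a unit current from the point \<open>x\<close> to
  \<open>p\<close>, and \<open>J x\<close> is its extension to all points of \<open>\<Gamma>\<close>.
\<close>

definition K :: "('v, 'e) point \<Rightarrow> 'v \<Rightarrow> real" where
  "K x v = lin \<Gamma> (\<lambda>w. G w v) x"

definition J :: "('v, 'e) point \<Rightarrow> ('v, 'e) point \<Rightarrow> real" where
  "J x z = lin \<Gamma> (K x) z + (case z of Vertex v \<Rightarrow> 0 | Interior e t \<Rightarrow> bump \<Gamma> x e t)"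

text \<open>As far as the vertices can tell, a unit current entering at coordinate \<open>t\<close>
  of an edge enters at its ends in the proportions \<open>1 - c\<close> and
  \<open>c\<close>.\<close>

lemma energy_K:
  assumes "x \<in> points \<Gamma>"
  shows "energy \<Gamma> g (K x) = lin \<Gamma> g x - g p"
proof (cases x)
  case (Vertex v)
  then have "v \<in> vertex_set \<Gamma>"
    using assms by (auto simp: points_def)
  moreover have "K x = G v"
    using Vertex by (auto simp: K_def lin_def)
  ultimately show ?thesis
    using potential_G[of v] Vertex by (simp add: potential_def lin_def)
next
  case (Interior e t)
  then have e: "e \<in> E"
    using assms by (auto simp: points_def)
  define c where "c = t / len \<Gamma> e"
  have "K x = (\<lambda>v. (1 - c) * G (src e) v + c * G (tgt e) v)"
    using Interior by (auto simp: K_def lin_def c_def algebra_simps)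
  then have "energy \<Gamma> g (K x) = (1 - c) * (g (src e) - g p) + c * (g (tgt e) - g p)"
    using potential_G[of "src e"] potential_G[of "tgt e"] e
    by (simp add: energy_add energy_scale potential_def)
  then show ?thesis
    using Interior by (simp add: lin_def c_def algebra_simps)
qed

lemma J_sym:
  assumes "x \<in> points \<Gamma>" "z \<in> points \<Gamma>"
  shows "J x z = J z x"
proof -
  have "G (src e) v = G v (src e)" "G (tgt e) v = G v (tgt e)" if "e \<in> E" "v \<in> vertex_set \<Gamma>" for e v
    using G_sym that by simp_all
  then show ?thesis
    using assms
    by (cases x; cases z)
      (auto simp: J_def K_def lin_def bump_def points_def G_sym min.commute algebra_simps)
qed

text \<open>One formula covers the ends as well as the interior of an edge, because the bump
  vanishes at both ends.\<close>

lemma J_edge_point: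
  assumes "e \<in> E" "0 \<le> t" "t \<le> len \<Gamma> e" "x \<in> points \<Gamma>"
  shows "J x (edge_point \<Gamma> e t) =
    K x (src e) + t * ((K x (tgt e) - K x (src e)) / len \<Gamma> e) + bump \<Gamma> x e t"
proof -
  have "bump \<Gamma> x e 0 = 0" "bump \<Gamma> x e (len \<Gamma> e) = 0"
    using assms len_pos[of e] by (auto simp: bump_def points_def split: point.split)
  then show ?thesis
    using assms len_pos[of e] by (auto simp: J_def lin_def edge_point_def)
qed

section \<open>Potentials on a subdivision\<close>

context
  fixes S :: "('v, 'e) point set"
  assumes S: "S \<subseteq> points \<Gamma>" "finite S"
begin

lemma breakpoints_bounds:
  "e \<in> E \<Longrightarrow> s \<in> breakpoints \<Gamma> S e \<Longrightarrow> 0 \<le> s \<and> s \<le> len \<Gamma> e"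
  using S len_pos[of e] by (auto simp: breakpoints_def points_def)

lemma finite_breakpoints: "finite (breakpoints \<Gamma> S e)"
proof -
  have "{t. Interior e t \<in> S} = Interior e -` S" by auto
  then show ?thesis
    using S(2) by (auto simp: breakpoints_def intro!: finite_vimageI injI)
qed

lemma Min_breakpoints: "e \<in> E \<Longrightarrow> Min (breakpoints \<Gamma> S e) = 0"
  using finite_breakpoints breakpoints_bounds by (intro Min_eqI) (auto simp: breakpoints_def)

lemma Max_breakpoints: "e \<in> E \<Longrightarrow> Max (breakpoints \<Gamma> S e) = len \<Gamma> e"
  using finite_breakpoints breakpoints_bounds by (intro Max_eqI) (auto simp: breakpoints_def)

lemma edge_set_refine: "edge_set (refine \<Gamma> S) = (SIGMA e:E. consecutive (breakpoints \<Gamma> S e))"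
  by (auto simp: refine_def consecutive_def)

lemma vertex_set_refine: "vertex_set (refine \<Gamma> S) = Vertex ` vertex_set \<Gamma> \<union> S"
  by (simp add: refine_def)

lemma edge_point_in_refine:
  assumes "e \<in> E" "s \<in> breakpoints \<Gamma> S e"
  shows "edge_point \<Gamma> e s \<in> Vertex ` vertex_set \<Gamma> \<union> S"
  using assms breakpoints_bounds[OF assms] len_pos[of e]
  by (auto simp: edge_point_def breakpoints_def)

lemma fin_digraph_refine: "fin_digraph (skeleton (refine \<Gamma> S))"
proof
  fix d
  assume "d \<in> edge_set (refine \<Gamma> S)"
  then obtain e s t where d: "d = (e, s, t)" "e \<in> E" "s \<in> breakpoints \<Gamma> S e" "t \<in> breakpoints \<Gamma> S e"
    by (auto simp: edge_set_refine consecutive_def)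
  then show "tail (skeleton (refine \<Gamma> S)) d \<in> vertex_set (refine \<Gamma> S)"
    and "head (skeleton (refine \<Gamma> S)) d \<in> vertex_set (refine \<Gamma> S)"
    unfolding vertex_set_refine using edge_point_in_refine by (auto simp: refine_def)
next
  show "finite (vertex_set (refine \<Gamma> S))"
    using S(2) by (simp add: vertex_set_refine)
  show "finite (edge_set (refine \<Gamma> S))"
    using finite_consecutive[OF finite_breakpoints] by (auto simp: edge_set_refine)
qed

text \<open>The reproducing property of the bump: its energy pairing with \<open>\<gamma>\<close> is
  the amount by which \<open>\<gamma>\<close> at \<open>u\<close> exceeds the linear interpolation
  of its end values.\<close>

lemma sum_consecutive_bump:
  assumes "e \<in> E" "x \<in> S"
  shows "(\<Sum>(s, t)\<in>consecutive (breakpoints \<Gamma> S e).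
      (\<gamma> t - \<gamma> s) * (bump \<Gamma> x e t - bump \<Gamma> x e s) / (t - s)) =
    (case x of Vertex v \<Rightarrow> 0
      | Interior e' u \<Rightarrow> if e' = e then \<gamma> u - \<gamma> 0 - u / len \<Gamma> e * (\<gamma> (len \<Gamma> e) - \<gamma> 0) else 0)"
proof (cases "\<exists>u. x = Interior e u")
  case True
  then obtain u where x: "x = Interior e u" by blast
  let ?B = "breakpoints \<Gamma> S e"
  define c where "c = u / len \<Gamma> e"
  have u: "u \<in> ?B"
    using x assms by (simp add: breakpoints_def)
  have "(\<Sum>(s, t)\<in>consecutive ?B. (\<gamma> t - \<gamma> s) * (bump \<Gamma> x e t - bump \<Gamma> x e s) / (t - s)) =
      (\<Sum>(s, t)\<in>consecutive ?B. (\<gamma> t - \<gamma> s) * (min t u - min s u) / (t - s) - c * (\<gamma> t - \<gamma> s))"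
  proof (rule sum.cong, rule refl, clarify)
    fix s t
    assume "(s, t) \<in> consecutive ?B"
    then have "s < t" by (simp add: consecutive_def)
    moreover have "0 < len \<Gamma> e" using len_pos assms by simp
    ultimately show "(\<gamma> t - \<gamma> s) * (bump \<Gamma> x e t - bump \<Gamma> x e s) / (t - s) =
        (\<gamma> t - \<gamma> s) * (min t u - min s u) / (t - s) - c * (\<gamma> t - \<gamma> s)"
      by (simp add: x bump_def c_def field_simps)
  qed
  also have "\<dots> = \<gamma> u - \<gamma> 0 - c * (\<gamma> (len \<Gamma> e) - \<gamma> 0)"
    using sum_consecutive_min[OF finite_breakpoints u, of \<gamma>]
      sum_consecutive[OF finite_breakpoints, of e \<gamma>] u assms(1)
    unfolding case_prod_beta' sum_subtractf[of "\<lambda>x. _ x / _ x"] sum_distrib_left[symmetric]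
    by (auto simp: Min_breakpoints Max_breakpoints)
  finally show ?thesis by (simp add: x c_def)
next
  case False
  then have "bump \<Gamma> x e t = 0" for t
    by (auto simp: bump_def split: point.split)
  then show ?thesis
    using False by (auto split: point.split)
qed

lemma sum_bump_defect:
  assumes "x \<in> S"
  shows "(\<Sum>e\<in>E. case x of Vertex v \<Rightarrow> 0
      | Interior e' u \<Rightarrow> if e' = e then g (edge_point \<Gamma> e u) - g (Vertex (src e)) -
           u / len \<Gamma> e * (g (Vertex (tgt e)) - g (Vertex (src e))) else (0::real)) =
    g x - lin \<Gamma> (g \<circ> Vertex) x"
proof (cases x)
  case (Interior e u)
  then have "e \<in> E" "edge_point \<Gamma> e u = x"
    using assms S by (auto simp: points_def edge_point_def)
  then show ?thesis
    using Interior by (simp add: lin_def)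
qed (simp add: lin_def)

text \<open>Along each edge \<open>J x - J y\<close> is a linear function plus a difference of
  bumps. The linear parts telescope to an energy on \<open>\<Gamma>\<close>, which by
  \<open>energy_K\<close> sees only the interpolation of \<open>g\<close>; the bumps add what
  separates \<open>g\<close> from its interpolation at \<open>x\<close> and at
  \<open>y\<close>.\<close>

lemma potential_refine:
  assumes x: "x \<in> S" and y: "y \<in> S"
  shows "potential (refine \<Gamma> S) x y (\<lambda>z. J x z - J y z)"
  unfolding potential_def
proof
  fix g :: "('v, 'e) point \<Rightarrow> real"
  let ?C = "\<lambda>e. consecutive (breakpoints \<Gamma> S e)"
  \<comment> \<open>Written with the factor -1 so that \<open>energy_add\<close> and
    \<open>energy_scale\<close> apply.\<close>
  let ?k = "\<lambda>v. K x v + - 1 * K y v"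
  define \<gamma> where "\<gamma> e s = g (edge_point \<Gamma> e s)" for e s
  define defect where "defect x e = (case x of Vertex v \<Rightarrow> 0
      | Interior e' u \<Rightarrow> if e' = e then \<gamma> e u - \<gamma> e 0 - u / len \<Gamma> e * (\<gamma> e (len \<Gamma> e) - \<gamma> e 0) else 0)"
    for x :: "('v, 'e) point" and e
  have \<gamma>: "\<gamma> e 0 = g (Vertex (src e))" "\<gamma> e (len \<Gamma> e) = g (Vertex (tgt e))" if "e \<in> E" for e
    using len_pos[OF that] by (auto simp: \<gamma>_def edge_point_def)
  have xy: "x \<in> points \<Gamma>" "y \<in> points \<Gamma>" using x y S by auto
  have defect: "(\<Sum>e\<in>E. defect x e) = g x - lin \<Gamma> (g \<circ> Vertex) x" if "x \<in> S" for x
    unfolding sum_bump_defect[OF that, symmetric] defect_def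
    by (intro sum.cong refl) (simp add: \<gamma> \<gamma>_def[symmetric] split: point.split)
  have "energy (refine \<Gamma> S) g (\<lambda>z. J x z - J y z) =
      (\<Sum>e\<in>E. \<Sum>(s, t)\<in>?C e. (\<gamma> e t - \<gamma> e s) *
        ((J x (edge_point \<Gamma> e t) - J y (edge_point \<Gamma> e t)) -
         (J x (edge_point \<Gamma> e s) - J y (edge_point \<Gamma> e s))) / (t - s))"
    unfolding energy_def edge_set_refine using finite_consecutive[OF finite_breakpoints]
    by (subst sum.Sigma) (auto simp: refine_def \<gamma>_def intro!: sum.cong)
  also have "\<dots> = (\<Sum>e\<in>E. (g (Vertex (tgt e)) - g (Vertex (src e))) * (?k (tgt e) - ?k (src e)) / len \<Gamma> e
      + (defect x e - defect y e))"
  proof (rule sum.cong[OF refl])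
    fix e
    assume e: "e \<in> E"
    define d where "d = (?k (tgt e) - ?k (src e)) / len \<Gamma> e"
    have "(\<Sum>(s, t)\<in>?C e. (\<gamma> e t - \<gamma> e s) *
        ((J x (edge_point \<Gamma> e t) - J y (edge_point \<Gamma> e t)) -
         (J x (edge_point \<Gamma> e s) - J y (edge_point \<Gamma> e s))) / (t - s)) =
      (\<Sum>(s, t)\<in>?C e. d * (\<gamma> e t - \<gamma> e s) +
        ((\<gamma> e t - \<gamma> e s) * (bump \<Gamma> x e t - bump \<Gamma> x e s) / (t - s) -
         (\<gamma> e t - \<gamma> e s) * (bump \<Gamma> y e t - bump \<Gamma> y e s) / (t - s)))"
    proof (rule sum.cong, rule refl, clarify)
      fix s t
      assume "(s, t) \<in> ?C e"
      then have st: "s < t" "0 \<le> s" "s \<le> len \<Gamma> e" "0 \<le> t" "t \<le> len \<Gamma> e"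
        using breakpoints_bounds[OF e] by (auto simp: consecutive_def)
      have eq: "(J x (edge_point \<Gamma> e t) - J y (edge_point \<Gamma> e t)) -
          (J x (edge_point \<Gamma> e s) - J y (edge_point \<Gamma> e s)) =
          d * (t - s) + ((bump \<Gamma> x e t - bump \<Gamma> x e s) - (bump \<Gamma> y e t - bump \<Gamma> y e s))"
        using st e xy by (simp add: J_edge_point d_def algebra_simps diff_divide_distrib add_divide_distrib)
      have "a * (d * r + (b - c)) / r = d * a + (a * b / r - a * c / r)" if "r \<noteq> 0" for a b c r :: real
        using that by (simp add: field_simps)
      from this[of "t - s"] st(1) show "(\<gamma> e t - \<gamma> e s) *
        ((J x (edge_point \<Gamma> e t) - J y (edge_point \<Gamma> e t)) -
         (J x (edge_point \<Gamma> e s) - J y (edge_point \<Gamma> e s))) / (t - s) =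
         d * (\<gamma> e t - \<gamma> e s) +
        ((\<gamma> e t - \<gamma> e s) * (bump \<Gamma> x e t - bump \<Gamma> x e s) / (t - s) -
         (\<gamma> e t - \<gamma> e s) * (bump \<Gamma> y e t - bump \<Gamma> y e s) / (t - s))"
        unfolding eq by simp
    qed
    also have "\<dots> = d * (\<gamma> e (len \<Gamma> e) - \<gamma> e 0) + (defect x e - defect y e)"
    proof -
      have "breakpoints \<Gamma> S e \<noteq> {}" by (auto simp: breakpoints_def)
      from sum_consecutive[OF finite_breakpoints this, of "\<gamma> e"]
        sum_consecutive_bump[OF e x, of "\<gamma> e"] sum_consecutive_bump[OF e y, of "\<gamma> e"]
      show ?thesis
        unfolding defect_def
        by (simp add: case_prod_beta' sum.distrib sum_subtractf sum_distrib_left[symmetric]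
            Min_breakpoints[OF e] Max_breakpoints[OF e])
    qed
    finally show "(\<Sum>(s, t)\<in>?C e. (\<gamma> e t - \<gamma> e s) *
        ((J x (edge_point \<Gamma> e t) - J y (edge_point \<Gamma> e t)) -
         (J x (edge_point \<Gamma> e s) - J y (edge_point \<Gamma> e s))) / (t - s)) =
      (g (Vertex (tgt e)) - g (Vertex (src e))) * (?k (tgt e) - ?k (src e)) / len \<Gamma> e
      + (defect x e - defect y e)"
      by (simp add: d_def \<gamma>[OF e] mult.commute)
  qed
  also have "\<dots> = energy \<Gamma> (g \<circ> Vertex) ?k + (g x - lin \<Gamma> (g \<circ> Vertex) x) - (g y - lin \<Gamma> (g \<circ> Vertex) y)"
    by (simp add: sum.distrib sum_subtractf defect x y energy_def)
  also have "energy \<Gamma> (g \<circ> Vertex) ?k = lin \<Gamma> (g \<circ> Vertex) x - lin \<Gamma> (g \<circ> Vertex) y"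
    unfolding energy_add energy_scale energy_K[OF xy(1)] energy_K[OF xy(2)] by simp
  finally show "energy (refine \<Gamma> S) g (\<lambda>z. J x z - J y z) = g x - g y" by (simp add: o_def)
qed

end

lemma resistance_J:
  assumes "x \<in> points \<Gamma>" "y \<in> points \<Gamma>"
  shows "resistance \<Gamma> x y = J x x + J y y - 2 * J y x"
proof -
  let ?S = "{x, y}"
  have S: "?S \<subseteq> points \<Gamma>" "finite ?S" using assms by auto
  have "network_resistance (refine \<Gamma> ?S) x y = (J x x - J y x) - (J x y - J y y)"
    using fin_digraph_refine[OF S] potential_refine[OF S, of x y]
    by (intro network_resistance_eq) (auto simp: vertex_set_refine[OF S])
  then show ?thesis
    using J_sym[OF assms] by (simp add: resistance_def)
qed

end

section \<open>A formula for the tau constant\<close>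

lemma has_integral_affine_square:
  fixes A B :: real
  assumes "a \<le> b"
  shows "((\<lambda>t. (A - B * t)\<^sup>2) has_integral
    (A\<^sup>2 * (b - a) - A * B * (b\<^sup>2 - a\<^sup>2) + B\<^sup>2 * (b ^ 3 - a ^ 3) / 3)) {a..b}"
proof -
  define F where "F t = A\<^sup>2 * t - A * B * t\<^sup>2 + B\<^sup>2 * t ^ 3 / 3" for t
  have "(F has_vector_derivative (A - B * t)\<^sup>2) (at t within {a..b})" for t
    unfolding F_def has_real_derivative_iff_has_vector_derivative[symmetric]
    by (auto intro!: derivative_eq_intros simp: power2_eq_square algebra_simps)
  then have "((\<lambda>t. (A - B * t)\<^sup>2) has_integral (F b - F a)) {a..b}"
    using assms by (intro fundamental_theorem_of_calculus) auto
  then show ?thesis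
    by (simp add: F_def algebra_simps diff_divide_distrib)
qed

section \<open>Integrating the squared derivative over an edge\<close>

context green_function
begin

text \<open>Along \<open>e\<close> the diagonal \<open>J x x\<close> is a quadratic polynomial in
  the coordinate, with coefficients \<open>slope e\<close> and \<open>- \<kappa> e\<close> (see
  \<open>J_diag\<close>). The bracket is the resistance r between the ends of \<open>e\<close>, so
  that \<open>\<kappa> e\<close> is (L - r) / L^2.\<close>

definition \<kappa> :: "'e \<Rightarrow> real" where
  "\<kappa> e = 1 / len \<Gamma> e - (G (src e) (src e) + G (tgt e) (tgt e) - 2 * G (src e) (tgt e)) / (len \<Gamma> e)\<^sup>2"

definition slope :: "'e \<Rightarrow> real" where
  "slope e = 2 * (G (src e) (tgt e) - G (src e) (src e)) / len \<Gamma> e + 1"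

definition K_slope :: "('v, 'e) point \<Rightarrow> 'e \<Rightarrow> real" where
  "K_slope y e = (K y (tgt e) - K y (src e)) / len \<Gamma> e"

definition at_point :: "('v, 'e) point \<Rightarrow> 'e \<Rightarrow> (real \<Rightarrow> real) \<Rightarrow> real" where
  "at_point y e f = (case y of Vertex v \<Rightarrow> 0 | Interior e' u \<Rightarrow> if e' = e then f u else 0)"

lemma interior_in_points: "e \<in> E \<Longrightarrow> 0 < t \<Longrightarrow> t < len \<Gamma> e \<Longrightarrow> edge_point \<Gamma> e t \<in> points \<Gamma>"
  by (simp add: edge_point_def points_def)

lemma J_diag:
  assumes "e \<in> E" "0 < t" "t < len \<Gamma> e"
  shows "J (edge_point \<Gamma> e t) (edge_point \<Gamma> e t) = G (src e) (src e) + slope e * t - \<kappa> e * t\<^sup>2"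
proof -
  have "G (tgt e) (src e) = G (src e) (tgt e)"
    using assms by (intro G_sym) auto
  moreover have "edge_point \<Gamma> e t = Interior e t"
    using assms by (simp add: edge_point_def)
  ultimately show ?thesis
    using assms interior_in_points[OF assms]
    by (subst J_edge_point)
      (auto simp: K_def lin_def bump_def slope_def \<kappa>_def field_simps power2_eq_square)
qed

lemma resistance_edge_point:
  assumes "e \<in> E" "0 < t" "t < len \<Gamma> e" "y \<in> points \<Gamma>"
  shows "resistance \<Gamma> (edge_point \<Gamma> e t) y =
    J y y + G (src e) (src e) + slope e * t - \<kappa> e * t\<^sup>2 - 2 * (K y (src e) + t * K_slope y e + bump \<Gamma> y e t)"
  using resistance_J[OF interior_in_points[OF assms(1-3)] assms(4)] J_diag[OF assms(1-3)]
    J_edge_point[of e t y] assms by (simp add: K_slope_def)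

lemma bump_deriv:
  assumes "y \<noteq> Interior e t"
  shows "(bump \<Gamma> y e has_real_derivative at_point y e (\<lambda>u. of_bool (t < u) - u / len \<Gamma> e)) (at t)"
proof (cases "\<exists>u. y = Interior e u")
  case True
  then obtain u where y: "y = Interior e u" by blast
  then have "t \<noteq> u" using assms by auto
  have bump_eq: "bump \<Gamma> y e = (\<lambda>s. min s u - s * (u / len \<Gamma> e))"
    by (auto simp: bump_def y)
  have "((\<lambda>s. min s u) has_real_derivative of_bool (t < u)) (at t)"
  proof (cases "t < u")
    case True
    have "((\<lambda>s. s) has_real_derivative 1) (at t)" by (rule DERIV_ident)
    then have "((\<lambda>s. min s u) has_real_derivative 1) (at t)"
      by (rule has_field_derivative_transform_within_open[where S = "{..<u}"]) (use True in auto)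
    then show ?thesis using True by simp
  next
    case False
    have "((\<lambda>s. u) has_real_derivative 0) (at t)" by (rule DERIV_const)
    then have "((\<lambda>s. min s u) has_real_derivative 0) (at t)"
      by (rule has_field_derivative_transform_within_open[where S = "{u<..}"]) (use False \<open>t \<noteq> u\<close> in auto)
    then show ?thesis using False by simp
  qed
  then have "((\<lambda>s. min s u - s * c) has_real_derivative of_bool (t < u) - c) (at t)" for c
    by (auto intro!: derivative_eq_intros)
  from this[of "u / len \<Gamma> e"] show ?thesis
    unfolding bump_eq by (simp add: y at_point_def)
next
  case False
  then have "bump \<Gamma> y e = (\<lambda>s. 0)"
    by (auto simp: bump_def split: point.split)
  then show ?thesis
    using False by (auto simp: at_point_def split: point.split)
qed

lemma deriv_resistance:
  assumes "e \<in> E" "0 < t" "t < len \<Gamma> e" "y \<in> points \<Gamma>" "y \<noteq> Interior e t"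
  shows "deriv (\<lambda>s. resistance \<Gamma> (edge_point \<Gamma> e s) y) t =
    slope e - 2 * K_slope y e - 2 * at_point y e (\<lambda>u. of_bool (t < u) - u / len \<Gamma> e) - 2 * \<kappa> e * t"
    (is "_ = ?D")
proof (rule DERIV_imp_deriv)
  have "((\<lambda>s. J y y + G (src e) (src e) + slope e * s - \<kappa> e * s\<^sup>2 -
      2 * (K y (src e) + s * K_slope y e + bump \<Gamma> y e s)) has_real_derivative ?D) (at t)"
    using bump_deriv[OF assms(5)]
    by (auto intro!: derivative_eq_intros simp: algebra_simps)
  then show "((\<lambda>s. resistance \<Gamma> (edge_point \<Gamma> e s) y) has_real_derivative ?D) (at t)"
    by (rule has_field_derivative_transform_within_open[where S = "{0<..<len \<Gamma> e}"])
      (use assms resistance_edge_point in auto)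
qed

text \<open>The quadratic of \<open>J_diag\<close> takes the value at the head when the coordinate
  is the full length.\<close>

lemma diag_difference:
  "e \<in> E \<Longrightarrow> G (tgt e) (tgt e) - G (src e) (src e) = slope e * len \<Gamma> e - \<kappa> e * (len \<Gamma> e)\<^sup>2"
  using len_pos[of e] by (simp add: slope_def \<kappa>_def field_simps power2_eq_square)

text \<open>Up to a constant the resistance is q - 2 h, with q the diagonal \<open>J x x\<close> and
  h the function \<open>J y\<close>. The three lines are the integrals of q'^2, of -4 q' h' and of 4
  h'^2. For \<open>y\<close> at coordinate u, integration by parts turns the bump's share of the
  second into 2 \<open>\<kappa> e\<close> times its integral u (L - u) / 2; the integral of its
  squared derivative is its peak u - u^2 / L.\<close>

lemma integral_edge:
  assumes e: "e \<in> E" and y: "y \<in> points \<Gamma>"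
  shows "integral {0..len \<Gamma> e} (\<lambda>t. (deriv (\<lambda>s. resistance \<Gamma> (edge_point \<Gamma> e s) y) t)\<^sup>2) =
    (\<kappa> e)\<^sup>2 * len \<Gamma> e ^ 3 / 3 + (G (tgt e) (tgt e) - G (src e) (src e))\<^sup>2 / len \<Gamma> e
    - 4 * (K_slope y e * (G (tgt e) (tgt e) - G (src e) (src e)) + at_point y e (\<lambda>u. \<kappa> e * u * (len \<Gamma> e - u)))
    + 4 * ((K_slope y e)\<^sup>2 * len \<Gamma> e + at_point y e (\<lambda>u. u - u\<^sup>2 / len \<Gamma> e))"
    (is "integral _ ?f = ?I")
proof -
  let ?L = "len \<Gamma> e" and ?\<kappa> = "\<kappa> e" and ?A = "slope e - 2 * K_slope y e"
  have L: "0 < ?L" using len_pos e by simp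
  have deriv: "?f t = (?A - 2 * at_point y e (\<lambda>u. of_bool (t < u) - u / ?L) - 2 * ?\<kappa> * t)\<^sup>2"
    if "0 < t" "t < ?L" "y \<noteq> Interior e t" for t
    using deriv_resistance[OF e that(1,2) y that(3)] by simp
  have "(?f has_integral ?I) {0..?L}"
  proof (cases "\<exists>u. y = Interior e u")
    case False
    then have at: "at_point y e f = 0" for f
      by (auto simp: at_point_def split: point.split)
    have int: "((\<lambda>t. (?A - 2 * ?\<kappa> * t)\<^sup>2) has_integral ?I) {0..?L}"
    proof (rule has_integral_eq_rhs[OF has_integral_affine_square])
      show "?I = ?A\<^sup>2 * (?L - 0) - ?A * (2 * ?\<kappa>) * (?L\<^sup>2 - 0\<^sup>2) + (2 * ?\<kappa>)\<^sup>2 * (?L ^ 3 - 0 ^ 3) / 3"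
        unfolding diag_difference[OF e] at using L
        by (simp add: field_simps power2_eq_square power3_eq_cube)
    qed (use L in simp)
    show ?thesis
      by (rule has_integral_spike_finite[where S = "{0, ?L}", OF _ _ int])
        (use False in \<open>auto simp: deriv at\<close>)
  next
    case True
    then obtain u where yu: "y = Interior e u" by blast
    then have u: "0 < u" "u < ?L"
      using y by (auto simp: points_def)
    let ?B = "?A + 2 * u / ?L"
    have left: "?f t = (?B - 2 - 2 * ?\<kappa> * t)\<^sup>2" if "0 < t" "t < u" for t
      using deriv[of t] that u by (simp add: yu at_point_def algebra_simps)
    have right: "?f t = (?B - 2 * ?\<kappa> * t)\<^sup>2" if "u < t" "t < ?L" for t
      using deriv[of t] that u by (simp add: yu at_point_def algebra_simps)
    \<comment> \<open>The derivative of the bump jumps from 1 - u / L to - u / L at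
      \<open>y\<close>, so the integral is split there.\<close>
    have 1: "(?f has_integral
        ((?B - 2)\<^sup>2 * (u - 0) - (?B - 2) * (2 * ?\<kappa>) * (u\<^sup>2 - 0\<^sup>2) + (2 * ?\<kappa>)\<^sup>2 * (u ^ 3 - 0 ^ 3) / 3)) {0..u}"
      by (rule has_integral_spike_finite[where S = "{0, u}", OF _ _ has_integral_affine_square])
        (use u left in auto)
    have 2: "(?f has_integral
        (?B\<^sup>2 * (?L - u) - ?B * (2 * ?\<kappa>) * (?L\<^sup>2 - u\<^sup>2) + (2 * ?\<kappa>)\<^sup>2 * (?L ^ 3 - u ^ 3) / 3)) {u..?L}"
      by (rule has_integral_spike_finite[where S = "{u, ?L}", OF _ _ has_integral_affine_square])
        (use u right in auto)
    show ?thesis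
    proof (rule has_integral_eq_rhs[OF has_integral_combine[OF _ _ 1 2]])
      show "?I = ((?B - 2)\<^sup>2 * (u - 0) - (?B - 2) * (2 * ?\<kappa>) * (u\<^sup>2 - 0\<^sup>2) + (2 * ?\<kappa>)\<^sup>2 * (u ^ 3 - 0 ^ 3) / 3) +
        (?B\<^sup>2 * (?L - u) - ?B * (2 * ?\<kappa>) * (?L\<^sup>2 - u\<^sup>2) + (2 * ?\<kappa>)\<^sup>2 * (?L ^ 3 - u ^ 3) / 3)"
        unfolding diag_difference[OF e] using L
        by (simp add: at_point_def yu field_simps power2_eq_square power3_eq_cube)
    qed (use u in auto)
  qed
  then show ?thesis by (rule integral_unique)
qed

text \<open>For \<open>y\<close> inside an edge, these terms are what the diagonal and
  \<open>J y\<close> have at \<open>y\<close> beyond the interpolation of their values at the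
  ends.\<close>

lemma sum_at_point:
  assumes "y \<in> points \<Gamma>"
  shows "(\<Sum>e\<in>E. at_point y e (\<lambda>u. \<kappa> e * u * (len \<Gamma> e - u))) = J y y - lin \<Gamma> (\<lambda>v. G v v) y"
    and "(\<Sum>e\<in>E. at_point y e (\<lambda>u. u - u\<^sup>2 / len \<Gamma> e)) = J y y - lin \<Gamma> (K y) y"
proof -
  show "(\<Sum>e\<in>E. at_point y e (\<lambda>u. \<kappa> e * u * (len \<Gamma> e - u))) = J y y - lin \<Gamma> (\<lambda>v. G v v) y"
  proof (cases y)
    case (Interior e u)
    then have e: "e \<in> E" "0 < u" "u < len \<Gamma> e" "edge_point \<Gamma> e u = y"
      using assms by (auto simp: points_def edge_point_def)
    have "lin \<Gamma> (\<lambda>v. G v v) y = G (src e) (src e) + u / len \<Gamma> e * (slope e * len \<Gamma> e - \<kappa> e * (len \<Gamma> e)\<^sup>2)"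
      using diag_difference[OF e(1)] by (simp add: lin_def Interior)
    also have "u / len \<Gamma> e * (slope e * len \<Gamma> e - \<kappa> e * (len \<Gamma> e)\<^sup>2) = u * slope e - u * \<kappa> e * len \<Gamma> e"
      using len_pos[OF e(1)] by (simp add: field_simps power2_eq_square)
    finally show ?thesis
      using J_diag[OF e(1-3)] e
      by (simp add: at_point_def Interior algebra_simps power2_eq_square)
  qed (simp add: at_point_def J_def K_def lin_def)
  show "(\<Sum>e\<in>E. at_point y e (\<lambda>u. u - u\<^sup>2 / len \<Gamma> e)) = J y y - lin \<Gamma> (K y) y"
    using assms
    by (cases y) (auto simp: at_point_def J_def bump_def points_def power2_eq_square)
qed

text \<open>
  The terms depending on the base point cancel because the Green function \<open>J y\<close> reproduces
  both the diagonal \<open>J x x\<close> and itself at \<open>y\<close>.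
\<close>

lemma tau_at_eq:
  assumes y: "y \<in> points \<Gamma>"
  shows "tau_at \<Gamma> y = 1 / 4 * (\<Sum>e\<in>E. (\<kappa> e)\<^sup>2 * len \<Gamma> e ^ 3 / 3 +
    (G (tgt e) (tgt e) - G (src e) (src e))\<^sup>2 / len \<Gamma> e)"
proof -
  have 1: "(\<Sum>e\<in>E. K_slope y e * (G (tgt e) (tgt e) - G (src e) (src e))) = lin \<Gamma> (\<lambda>v. G v v) y"
  proof -
    have "(\<Sum>e\<in>E. K_slope y e * (G (tgt e) (tgt e) - G (src e) (src e))) = energy \<Gamma> (\<lambda>v. G v v) (K y)"
      unfolding energy_def K_slope_def by (intro sum.cong) auto
    then show ?thesis
      using energy_K[OF y] G_p[OF p] by simp
  qed
  have 2: "(\<Sum>e\<in>E. (K_slope y e)\<^sup>2 * len \<Gamma> e) = lin \<Gamma> (K y) y"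
  proof -
    have "(\<Sum>e\<in>E. (K_slope y e)\<^sup>2 * len \<Gamma> e) = energy \<Gamma> (K y) (K y)"
      unfolding energy_def K_slope_def
    proof (intro sum.cong refl)
      fix e
      assume "e \<in> E"
      then have "len \<Gamma> e \<noteq> 0" using len_pos by fastforce
      then show "((K y (tgt e) - K y (src e)) / len \<Gamma> e)\<^sup>2 * len \<Gamma> e =
          (K y (tgt e) - K y (src e)) * (K y (tgt e) - K y (src e)) / len \<Gamma> e"
        by (simp add: power2_eq_square)
    qed
    moreover have "K y p = 0"
      using y by (auto simp: K_def lin_def points_def G_p split: point.split)
    ultimately show ?thesis
      using energy_K[OF y] by simp
  qed
  show ?thesis
    unfolding tau_at_def using sum_at_point[OF y]
    by (simp add: integral_edge y sum.distrib sum_subtractf sum_distrib_left[symmetric] 1 2)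
qed

end

lemma green_function_exists:
  assumes N: "metrized_graph \<Gamma>" and p: "p \<in> vertex_set \<Gamma>"
  shows "\<exists>G. green_function \<Gamma> p G"
proof -
  have "\<exists>f. potential \<Gamma> x p f \<and> f p = 0" if x: "x \<in> vertex_set \<Gamma>" for x
  proof -
    obtain f where "potential \<Gamma> x p f"
      using potential_exists[OF N x p] by blast
    then have "potential \<Gamma> x p (\<lambda>v. f v - f p)"
      by (simp add: potential_def energy_def)
    then show ?thesis by (intro exI[of _ "\<lambda>v. f v - f p"]) simp
  qed
  then obtain G where "\<And>x. x \<in> vertex_set \<Gamma> \<Longrightarrow> potential \<Gamma> x p (G x) \<and> G x p = 0"
    by metis
  then show ?thesis
    using assms by (intro exI[of _ G]) (simp add: green_function_def)
qed

text \<open>With the ground at \<open>p\<close> the diagonal \<open>G v v\<close> is the resistance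
  from \<open>v\<close> to \<open>p\<close>. Without the Green function, the formula can be compared
  between two graphs.\<close>

lemma tau_eq:
  assumes N: "metrized_graph \<Gamma>" and p: "p \<in> vertex_set \<Gamma>"
  defines "a \<equiv> tail (skeleton \<Gamma>)" and "b \<equiv> head (skeleton \<Gamma>)" and "R \<equiv> network_resistance \<Gamma>"
  shows "tau \<Gamma> = 1 / 4 * (\<Sum>e\<in>edge_set \<Gamma>.
    (len \<Gamma> e - R (a e) (b e))\<^sup>2 / (3 * len \<Gamma> e) + (R (b e) p - R (a e) p)\<^sup>2 / len \<Gamma> e)"
proof -
  obtain G where "green_function \<Gamma> p G"
    using green_function_exists[OF N p] by blast
  then interpret green_function \<Gamma> p G .
  have "Vertex p \<in> points \<Gamma>"
    using p by (simp add: points_def)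
  then have "(SOME y. y \<in> points \<Gamma>) \<in> points \<Gamma>"
    by (rule someI)
  from tau_at_eq[OF this] have "tau \<Gamma> = 1 / 4 * (\<Sum>e\<in>E. (\<kappa> e)\<^sup>2 * len \<Gamma> e ^ 3 / 3 +
    (G (tgt e) (tgt e) - G (src e) (src e))\<^sup>2 / len \<Gamma> e)"
    by (simp add: tau_def)
  also have "(\<Sum>e\<in>E. (\<kappa> e)\<^sup>2 * len \<Gamma> e ^ 3 / 3 +
      (G (tgt e) (tgt e) - G (src e) (src e))\<^sup>2 / len \<Gamma> e) =
    (\<Sum>e\<in>E. (len \<Gamma> e - R (a e) (b e))\<^sup>2 / (3 * len \<Gamma> e) + (R (b e) p - R (a e) p)\<^sup>2 / len \<Gamma> e)"
  proof (intro sum.cong refl)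
    fix e
    assume e: "e \<in> E"
    have R: "R v p = G v v" if "v \<in> vertex_set \<Gamma>" for v
      using network_resistance_G[OF that p] G_p that p by (simp add: R_def)
    have "R (a e) (b e) = G (src e) (src e) + G (tgt e) (tgt e) - 2 * G (src e) (tgt e)"
      using network_resistance_G e by (simp add: R_def a_def b_def)
    then have "\<kappa> e = 1 / len \<Gamma> e - R (a e) (b e) / (len \<Gamma> e)\<^sup>2"
      by (simp add: \<kappa>_def)
    then have "\<kappa> e * (len \<Gamma> e)\<^sup>2 = len \<Gamma> e - R (a e) (b e)"
      using len_pos[OF e] by (simp add: field_simps power2_eq_square)
    then have "(len \<Gamma> e - R (a e) (b e))\<^sup>2 / (3 * len \<Gamma> e) = (\<kappa> e * (len \<Gamma> e)\<^sup>2)\<^sup>2 / (3 * len \<Gamma> e)"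
      by simp
    also have "\<dots> = (\<kappa> e)\<^sup>2 * len \<Gamma> e ^ 3 / 3"
      using len_pos[OF e] by (simp add: field_simps power2_eq_square power3_eq_cube)
    finally show "(\<kappa> e)\<^sup>2 * len \<Gamma> e ^ 3 / 3 + (G (tgt e) (tgt e) - G (src e) (src e))\<^sup>2 / len \<Gamma> e =
      (len \<Gamma> e - R (a e) (b e))\<^sup>2 / (3 * len \<Gamma> e) + (R (b e) p - R (a e) p)\<^sup>2 / len \<Gamma> e"
      using e by (simp add: R a_def b_def)
  qed
  finally show ?thesis .
qed

section \<open>Contracting an edge of a 2-edge cut\<close>

lemma network_resistance_commute:
  assumes N: "metrized_graph N" and ab: "a \<in> vertex_set N" "b \<in> vertex_set N"
  shows "network_resistance N a b = network_resistance N b a"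
proof -
  have fin: "fin_digraph (skeleton N)"
    using N by (simp add: metrized_graph_def)
  obtain f where f: "potential N a b f"
    using potential_exists[OF N ab] by blast
  show ?thesis
    using network_resistance_eq[OF fin ab f] network_resistance_eq[OF fin ab(2,1) potential_minus[OF f]]
    by simp
qed

text \<open>Superpose the currents from \<open>x\<close> to \<open>b\<close> and from
  \<open>b\<close> to \<open>a\<close>; reciprocity expresses the cross term through
  \<open>f\<close>, whence the factor 2.\<close>

lemma network_resistance_change_base:
  assumes N: "metrized_graph N" and x: "x \<in> vertex_set N" and a: "a \<in> vertex_set N"
    and b: "b \<in> vertex_set N" and f: "potential N b a f"
  shows "network_resistance N x a = network_resistance N x b + 2 * f x - f a - f b"
proof -
  have fin: "fin_digraph (skeleton N)"
    using N by (simp add: metrized_graph_def)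
  obtain g where g: "potential N x b g"
    using potential_exists[OF N x b] by blast
  have "network_resistance N x a = (g x + f x) - (g a + f a)"
    by (rule network_resistance_eq[OF fin x a potential_add[OF g f]])
  moreover have "network_resistance N x b = g x - g b"
    by (rule network_resistance_eq[OF fin x b g])
  ultimately show ?thesis
    using reciprocity[OF f g] by simp
qed

text \<open>Meant for edges crossing \<open>S\<close>, where it hides the orientation; the
  complement of \<open>S\<close> selects the other end.\<close>

definition cut_end :: "('v, 'e) pre_digraph \<Rightarrow> 'v set \<Rightarrow> 'e \<Rightarrow> 'v" where
  "cut_end G S e = (if tail G e \<in> S then tail G e else head G e)"

text \<open>The merged vertex keeps the name \<open>a\<close>, so the contraction has the same
  vertex and edge types and the step can be iterated.\<close>

definition contract :: "('v, 'e) metrized \<Rightarrow> 'e \<Rightarrow> 'e \<Rightarrow> 'v \<Rightarrow> 'v \<Rightarrow> ('v, 'e) metrized" where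
  "contract \<Gamma> e e' a b =
     \<lparr> skeleton =
         \<lparr> verts = vertex_set \<Gamma> - {b},
           arcs = edge_set \<Gamma> - {e},
           tail = id(b := a) \<circ> tail (skeleton \<Gamma>),
           head = id(b := a) \<circ> head (skeleton \<Gamma>) \<rparr>,
       len = (len \<Gamma>)(e' := len \<Gamma> e + len \<Gamma> e') \<rparr>"

text \<open>
  With \<open>x\<close>, \<open>y\<close> the resistances of the two sides of the cut, both sides are the
  cut-dependent part of \<open>4 \<tau>\<close>, before and after contraction.
\<close>

lemma contraction_identity:
  fixes L1 L2 x y D :: real
  assumes "L1 > 0" "L2 > 0" "D \<noteq> 0" "D = L1 + L2 + x + y"
  shows "(L1\<^sup>2 / D)\<^sup>2 / (3 * L1) + (L1 * (D - L1) / D)\<^sup>2 / L1 +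
      ((L2\<^sup>2 / D)\<^sup>2 / (3 * L2) + (L2 * (L1 + x - y) / D)\<^sup>2 / L2) - 4 * L1 * x * (L2 + y) / D\<^sup>2 =
    ((L1 + L2)\<^sup>2 / D)\<^sup>2 / (3 * (L1 + L2)) + ((L1 + L2) * (x - y) / D)\<^sup>2 / (L1 + L2)"
proof -
  \<comment> \<open>Every term becomes a cubic polynomial over \<open>D\<^sup>2\<close>, which
    reduces the claim to a polynomial identity.\<close>
  have sq: "(L\<^sup>2 / D)\<^sup>2 / (3 * L) = L ^ 3 / (3 * D\<^sup>2)" "(L * z / D)\<^sup>2 / L = L * z\<^sup>2 / D\<^sup>2"
    if "L > 0" for L z
    using that assms(3) by (simp_all add: field_simps power2_eq_square power3_eq_cube)
  have DL: "D - L1 = L2 + x + y" using assms(4) by simp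
  have "L1 ^ 3 / 3 + L1 * (L2 + x + y)\<^sup>2 + (L2 ^ 3 / 3 + L2 * (L1 + x - y)\<^sup>2) - 4 * L1 * x * (L2 + y) =
      (L1 + L2) ^ 3 / 3 + (L1 + L2) * (x - y)\<^sup>2"
    by (simp add: field_simps power2_eq_square power3_eq_cube)
  then have "(L1 ^ 3 / 3 + L1 * (L2 + x + y)\<^sup>2 + (L2 ^ 3 / 3 + L2 * (L1 + x - y)\<^sup>2) - 4 * L1 * x * (L2 + y)) / D\<^sup>2 =
      ((L1 + L2) ^ 3 / 3 + (L1 + L2) * (x - y)\<^sup>2) / D\<^sup>2"
    by simp
  then show ?thesis
    unfolding sq[OF assms(1)] sq[OF assms(2)] sq[OF add_pos_pos[OF assms(1,2)]] DL
    by (simp only: add_divide_distrib diff_divide_distrib divide_divide_eq_left)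
qed

text \<open>\<open>S\<close> is any set of the vertex type, so \<open>- S\<close> gives another
  instance (\<open>compl\<close>) and each result about \<open>S\<close> transfers to the other
  side.\<close>

locale two_edge_cut =
  fixes \<Gamma> :: "('v, 'e) metrized" and S :: "'v set" and e1 e2 :: 'e
  assumes metrized_graph: "metrized_graph \<Gamma>"
    and cut: "cut_arcs (skeleton \<Gamma>) S = {e1, e2}" and e1_neq_e2: "e1 \<noteq> e2"
    and no_bridge: "\<And>T. T \<subseteq> vertex_set \<Gamma> \<Longrightarrow> T \<noteq> {} \<Longrightarrow> T \<noteq> vertex_set \<Gamma> \<Longrightarrow>
      2 \<le> card (cut_arcs (skeleton \<Gamma>) T)"
begin

sublocale fin_digraph "skeleton \<Gamma>"
  using metrized_graph by (simp add: metrized_graph_def)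

abbreviation "V \<equiv> vertex_set \<Gamma>"
abbreviation "E \<equiv> edge_set \<Gamma>"
abbreviation "src \<equiv> tail (skeleton \<Gamma>)"
abbreviation "tgt \<equiv> head (skeleton \<Gamma>)"
abbreviation "R \<equiv> network_resistance \<Gamma>"
abbreviation "L1 \<equiv> len \<Gamma> e1"
abbreviation "L2 \<equiv> len \<Gamma> e2"
abbreviation "a1 \<equiv> cut_end (skeleton \<Gamma>) (- S) e1"
abbreviation "a2 \<equiv> cut_end (skeleton \<Gamma>) (- S) e2"
abbreviation "b1 \<equiv> cut_end (skeleton \<Gamma>) S e1"
abbreviation "b2 \<equiv> cut_end (skeleton \<Gamma>) S e2"

lemma compl: "two_edge_cut \<Gamma> (- S) e1 e2"
proof
  show "cut_arcs (skeleton \<Gamma>) (- S) = {e1, e2}"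
    using cut by (auto simp: cut_arcs_def)
qed (use metrized_graph e1_neq_e2 no_bridge in auto)

lemma len_pos: "e \<in> E \<Longrightarrow> 0 < len \<Gamma> e"
  using metrized_graph by (simp add: metrized_graph_def)

lemma cut_edges: "e1 \<in> E" "e2 \<in> E"
  using cut by (auto simp: cut_arcs_def)

lemma cut_lengths: "0 < L1" "0 < L2"
  using cut_edges len_pos by auto

lemma crossing: "(src e1 \<in> S) \<noteq> (tgt e1 \<in> S)" "(src e2 \<in> S) \<noteq> (tgt e2 \<in> S)"
  using cut by (auto simp: cut_arcs_def)

lemma cut_ends [simp]:
  "a1 \<in> V" "a2 \<in> V" "b1 \<in> V" "b2 \<in> V" "a1 \<notin> S" "a2 \<notin> S" "b1 \<in> S" "b2 \<in> S"
  using crossing cut_edges by (auto simp: cut_end_def)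

lemma not_crossing: "e \<in> E \<Longrightarrow> e \<noteq> e1 \<Longrightarrow> e \<noteq> e2 \<Longrightarrow> src e \<in> S \<longleftrightarrow> tgt e \<in> S"
  using cut by (auto simp: cut_arcs_def)

section \<open>Energy and currents on the two sides\<close>

definition inside :: "'v set \<Rightarrow> 'e set" where
  "inside X = {e \<in> E. src e \<in> X \<and> tgt e \<in> X}"

lemma sum_edges:
  "(\<Sum>e\<in>E. h e) = (\<Sum>e\<in>inside S. h e) + (\<Sum>e\<in>inside (- S). h e) + h e1 + (h e2 :: real)"
proof -
  have "E = inside S \<union> inside (- S) \<union> {e1, e2}"
    using not_crossing cut_edges by (auto simp: inside_def)
  moreover have "inside S \<inter> inside (- S) = {}" "(inside S \<union> inside (- S)) \<inter> {e1, e2} = {}"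
    using crossing by (auto simp: inside_def)
  moreover have "finite (inside X)" for X
    by (simp add: inside_def)
  ultimately show ?thesis
    using e1_neq_e2 by (simp add: sum.union_disjoint)
qed

definition side_energy :: "'v set \<Rightarrow> ('v \<Rightarrow> real) \<Rightarrow> ('v \<Rightarrow> real) \<Rightarrow> real" where
  "side_energy X g f = (\<Sum>e\<in>inside X. (g (tgt e) - g (src e)) * (f (tgt e) - f (src e)) / len \<Gamma> e)"

definition current1 :: "('v \<Rightarrow> real) \<Rightarrow> real" where "current1 f = (f b1 - f a1) / L1"
definition current2 :: "('v \<Rightarrow> real) \<Rightarrow> real" where "current2 f = (f b2 - f a2) / L2"

lemma cut_end_diff:
  "f (tgt e1) - f (src e1) = f b1 - f a1 \<or> f (tgt e1) - f (src e1) = - (f b1 - f a1 :: real)"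
  "f (tgt e2) - f (src e2) = f b2 - f a2 \<or> f (tgt e2) - f (src e2) = - (f b2 - f a2 :: real)"
  using crossing by (auto simp: cut_end_def)

text \<open>Reversing an edge changes the sign of both factors.\<close>

lemma cut_end_product:
  "(g (tgt e1) - g (src e1)) * (f (tgt e1) - f (src e1)) = (g b1 - g a1) * (f b1 - f a1 :: real)"
  "(g (tgt e2) - g (src e2)) * (f (tgt e2) - f (src e2)) = (g b2 - g a2) * (f b2 - f a2 :: real)"
  using crossing by (auto simp: cut_end_def algebra_simps)

lemma energy_split:
  "energy \<Gamma> g f = side_energy S g f + side_energy (- S) g f +
     (g b1 - g a1) * current1 f + (g b2 - g a2) * current2 f"
  unfolding energy_def sum_edges cut_end_product
  by (simp add: side_energy_def current1_def current2_def)

lemma side_energy_commute: "side_energy X g f = side_energy X f g"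
  by (simp add: side_energy_def mult.commute)

lemma side_energy_cong:
  assumes "\<And>v. v \<in> X \<Longrightarrow> v \<in> V \<Longrightarrow> g v = g' v"
  shows "side_energy X g f = side_energy X g' f"
  unfolding side_energy_def using assms by (intro sum.cong) (auto simp: inside_def)

text \<open>Test against \<open>g\<close> cut off to zero outside \<open>S\<close>: only the edges
  inside \<open>S\<close> and the two cut edges contribute.\<close>

lemma side_energy_potential:
  assumes "potential \<Gamma> x y f"
  shows "side_energy S g f = of_bool (x \<in> S) * g x - of_bool (y \<in> S) * g y -
    g b1 * current1 f - g b2 * current2 f"
proof -
  define h where "h v = of_bool (v \<in> S) * g v" for v
  have "side_energy S h f = side_energy S g f" "side_energy (- S) h f = side_energy (- S) (\<lambda>_. 0) f"
    by (auto intro!: side_energy_cong simp: h_def)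
  then have "energy \<Gamma> h f = side_energy S g f + g b1 * current1 f + g b2 * current2 f"
    by (simp add: energy_split h_def side_energy_def)
  then show ?thesis
    using assms by (simp add: potential_def h_def)
qed

text \<open>Kirchhoff's current law for \<open>S\<close> as a whole, obtained from the constant test
  function.\<close>

lemma current_sum:
  assumes "potential \<Gamma> x y f"
  shows "current1 f + current2 f = of_bool (x \<in> S) - of_bool (y \<in> S)"
  using side_energy_potential[OF assms, of "\<lambda>_. 1"] by (simp add: side_energy_def)

section \<open>A unit current between the ends of \<open>e1\<close>\<close>

context
  fixes \<phi> :: "'v \<Rightarrow> real"
  assumes \<phi>: "potential \<Gamma> b1 a1 \<phi>"
begin

lemma current1_\<phi>: "current1 \<phi> = 1 - current2 \<phi>"
  using current_sum[OF \<phi>] by simp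

text \<open>Of the unit entering at \<open>b1\<close>, one part leaves at once through
  \<open>e1\<close>. Inside \<open>S\<close>, therefore, \<open>\<phi>\<close> behaves like
  \<open>current2 \<phi>\<close> times a unit current from \<open>b1\<close> to
  \<open>b2\<close>.\<close>

lemma side_energy_\<phi>: "side_energy S g \<phi> = current2 \<phi> * (g b1 - g b2)"
  using side_energy_potential[OF \<phi>, of g] by (simp add: current1_\<phi> algebra_simps)

text \<open>Evaluate the energy of \<open>\<phi>\<close> and \<open>\<psi>\<close> inside
  \<open>S\<close> in two ways, once through each potential; reciprocity supplies the current of
  \<open>\<psi>\<close> through \<open>e1\<close>.\<close>

lemma side_resistance:
  "R b1 b2 * current2 \<phi> = (\<phi> b1 - \<phi> b2) * (1 - (\<phi> b1 - \<phi> b2) / L1)"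
proof -
  obtain \<psi> where \<psi>: "potential \<Gamma> b1 b2 \<psi>"
    using potential_exists[OF metrized_graph] cut_ends by blast
  have "current1 \<psi> = (\<phi> b1 - \<phi> b2) / L1" "current2 \<psi> = - current1 \<psi>"
    using reciprocity[OF \<psi> \<phi>] current_sum[OF \<psi>] by (simp_all add: current1_def)
  moreover have "side_energy S \<phi> \<psi> = (\<phi> b1 - \<phi> b2) * (1 - current1 \<psi>)"
    using side_energy_potential[OF \<psi>, of \<phi>] \<open>current2 \<psi> = _\<close> by (simp add: algebra_simps)
  moreover have "R b1 b2 = \<psi> b1 - \<psi> b2"
    by (rule network_resistance_eq[OF fin_digraph _ _ \<psi>]) simp_all
  ultimately show ?thesis
    using side_energy_\<phi>[of \<psi>] side_energy_commute[of S \<psi> \<phi>] by (simp add: mult.commute)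
qed

lemma resistance_e1: "R b1 a1 = L1 * (1 - current2 \<phi>)"
  using network_resistance_eq[OF fin_digraph _ _ \<phi>] current1_\<phi> cut_lengths
  by (simp add: current1_def field_simps)

lemma resistance_e2: "R b2 a2 = L2 * (1 - current2 \<phi> * L2 / L1)"
proof -
  obtain \<psi> where \<psi>: "potential \<Gamma> b2 a2 \<psi>"
    using potential_exists[OF metrized_graph] cut_ends by blast
  have "current1 \<psi> = current2 \<phi> * L2 / L1"
    using reciprocity[OF \<psi> \<phi>] cut_lengths by (simp add: current1_def current2_def)
  then have "current2 \<psi> = 1 - current2 \<phi> * L2 / L1"
    using current_sum[OF \<psi>] by simp
  moreover have "R b2 a2 = L2 * current2 \<psi>"
    using network_resistance_eq[OF fin_digraph _ _ \<psi>] cut_lengths by (simp add: current2_def)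
  ultimately show ?thesis by simp
qed

end

text \<open>If nothing returned through \<open>e2\<close>, all the energy of \<open>\<phi>\<close>
  would sit on \<open>e1\<close>. Then \<open>\<phi>\<close> is constant along every other edge, and
  its level set through \<open>b1\<close> is cut by \<open>e1\<close> alone, a bridge.\<close>

lemma current2_nonzero:
  assumes \<phi>: "potential \<Gamma> b1 a1 \<phi>"
  shows "current2 \<phi> \<noteq> 0"
proof
  assume 0: "current2 \<phi> = 0"
  have "side_energy S \<phi> \<phi> = 0"
    using side_energy_\<phi>[OF \<phi>, of \<phi>] 0 by simp
  moreover have "side_energy (- S) \<phi> \<phi> = 0"
    using energy_split[of \<phi> \<phi>] \<phi> calculation 0 current1_\<phi>[OF \<phi>] by (simp add: potential_def)
  moreover have "\<phi> (tgt e) = \<phi> (src e)" if "side_energy X \<phi> \<phi> = 0" "e \<in> inside X" for X e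
  proof -
    have "(\<phi> (tgt e) - \<phi> (src e)) * (\<phi> (tgt e) - \<phi> (src e)) / len \<Gamma> e = 0"
      using that unfolding side_energy_def
      by (subst (asm) sum_nonneg_eq_0_iff)
        (auto intro!: divide_nonneg_pos len_pos simp: inside_def)
    then show ?thesis
      using len_pos[of e] that(2) by (auto simp: inside_def)
  qed
  ultimately have flat: "\<phi> (tgt e) = \<phi> (src e)" if "e \<in> inside S \<or> e \<in> inside (- S)" for e
    using that by blast
  have "\<phi> (tgt e2) = \<phi> (src e2)"
    using 0 cut_lengths cut_end_diff(2)[of \<phi>] by (auto simp: current2_def)
  then have flat: "\<phi> (tgt e) = \<phi> (src e)" if "e \<in> E" "e \<noteq> e1" for e
    using flat[of e] that not_crossing[of e] by (auto simp: inside_def)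
  define T where "T = {v \<in> V. \<phi> v = \<phi> b1}"
  have "\<phi> a1 \<noteq> \<phi> b1"
    using current1_\<phi>[OF \<phi>] 0 by (auto simp: current1_def)
  then have "b1 \<in> T" "a1 \<notin> T" "T \<subseteq> V"
    by (simp_all add: T_def)
  then have "T \<subseteq> V" "T \<noteq> {}" "T \<noteq> V"
    using cut_ends(1) by blast+
  then have "2 \<le> card (cut_arcs (skeleton \<Gamma>) T)"
    by (rule no_bridge)
  also have "cut_arcs (skeleton \<Gamma>) T \<subseteq> {e1}"
    using flat unfolding cut_arcs_def T_def by fastforce
  then have "card (cut_arcs (skeleton \<Gamma>) T) \<le> card {e1}"
    by (intro card_mono) auto
  finally show False by simp
qed

section \<open>The contracted graph and its resistances\<close>

definition glue :: "'v \<Rightarrow> 'v" where "glue = id(b1 := a1)"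
abbreviation "\<beta> \<equiv> contract \<Gamma> e1 e2 a1 b1"

lemma glue_other [simp]: "v \<noteq> b1 \<Longrightarrow> glue v = v"
  by (simp add: glue_def)

lemma glue_b1 [simp]: "glue b1 = a1"
  by (simp add: glue_def)

lemma glue_other_side [simp]: "v \<notin> S \<Longrightarrow> glue v = v"
  using cut_ends(7) by (cases "v = b1") auto

lemma \<beta>_simps:
  "vertex_set \<beta> = V - {b1}" "edge_set \<beta> = E - {e1}"
  "tail (skeleton \<beta>) e = glue (src e)" "head (skeleton \<beta>) e = glue (tgt e)"
  "len \<beta> e = (if e = e2 then L1 + L2 else len \<Gamma> e)"
  by (simp_all add: contract_def glue_def)

lemma glue_in_contract: "v \<in> V \<Longrightarrow> glue v \<in> vertex_set \<beta>"
  using cut_ends(1,5,7) by (cases "v = b1") (auto simp: \<beta>_simps simp del: cut_ends)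

lemma fin_digraph_contract: "fin_digraph (skeleton \<beta>)"
proof
  fix e
  assume "e \<in> edge_set \<beta>"
  then have "e \<in> E" by (simp add: \<beta>_simps)
  then show "tail (skeleton \<beta>) e \<in> vertex_set \<beta>" "head (skeleton \<beta>) e \<in> vertex_set \<beta>"
    using glue_in_contract[of "src e"] glue_in_contract[of "tgt e"] by (simp_all add: \<beta>_simps)
qed (simp_all add: \<beta>_simps)

text \<open>Take the preimage of \<open>T\<close> under \<open>glue\<close>. Both ends of
  \<open>e1\<close> have the same image, so \<open>e1\<close> is not in the cut of the
  preimage.\<close>

lemma cut_contract:
  assumes T: "T \<subseteq> vertex_set \<beta>" "T \<noteq> {}" "T \<noteq> vertex_set \<beta>"
  shows "\<exists>U\<subseteq>V. U \<noteq> {} \<and> U \<noteq> V \<and> cut_arcs (skeleton \<beta>) T = cut_arcs (skeleton \<Gamma>) U"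
proof (intro exI conjI)
  define U where "U = {v \<in> V. glue v \<in> T}"
  show "U \<subseteq> V" by (auto simp: U_def)
  have same: "v \<in> U \<longleftrightarrow> v \<in> T" if "v \<in> vertex_set \<beta>" for v
    using that by (auto simp: U_def \<beta>_simps)
  show "U \<noteq> {}"
    using T same by auto
  obtain w where "w \<in> vertex_set \<beta>" "w \<notin> T"
    using T by blast
  then show "U \<noteq> V"
    using same[of w] by (auto simp: \<beta>_simps)
  have "src e1 = b1 \<and> tgt e1 = a1 \<or> src e1 = a1 \<and> tgt e1 = b1"
    using crossing by (auto simp: cut_end_def)
  then have "glue (src e1) = glue (tgt e1)"
    using glue_b1 glue_other_side[of a1] by (metis cut_ends(5))
  then have "e1 \<notin> cut_arcs (skeleton \<Gamma>) U"
    using cut_edges by (auto simp: cut_arcs_def U_def)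
  then show "cut_arcs (skeleton \<beta>) T = cut_arcs (skeleton \<Gamma>) U"
    by (auto simp: cut_arcs_def \<beta>_simps U_def)
qed

lemma metrized_graph_contract: "metrized_graph \<beta>"
  unfolding metrized_graph_def
proof (intro conjI ballI)
  show fin: "fin_digraph (skeleton \<beta>)" by (rule fin_digraph_contract)
  have wf: "wf_digraph (skeleton \<beta>)"
    using fin by (simp add: fin_digraph_def)
  have "vertex_set \<beta> \<noteq> {}"
    using glue_in_contract cut_ends(1) by blast
  moreover have "cut_arcs (skeleton \<beta>) T \<noteq> {}"
    if T: "T \<subseteq> vertex_set \<beta>" "T \<noteq> {}" "T \<noteq> vertex_set \<beta>" for T
  proof -
    obtain U where "U \<subseteq> V" "U \<noteq> {}" "U \<noteq> V" and *: "cut_arcs (skeleton \<beta>) T = cut_arcs (skeleton \<Gamma>) U"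
      using cut_contract[OF T] by blast
    then have "2 \<le> card (cut_arcs (skeleton \<Gamma>) U)"
      by (intro no_bridge)
    then show ?thesis unfolding * by auto
  qed
  ultimately show "Digraph_Component.connected (skeleton \<beta>)"
    unfolding connected_iff_cut[OF wf] by blast
  fix e
  assume "e \<in> edge_set \<beta>"
  then show "0 < len \<beta> e"
    using cut_lengths len_pos by (auto simp: \<beta>_simps)
qed

lemma sum_edges_contract:
  "(\<Sum>e\<in>edge_set \<beta>. h e) = (\<Sum>e\<in>inside S. h e) + (\<Sum>e\<in>inside (- S). h e) + (h e2 :: real)"
proof -
  have "edge_set \<beta> = E - {e1}" by (simp add: \<beta>_simps)
  then show ?thesis
    using sum_edges[of h] cut_edges by (simp add: sum_diff1)
qed

lemma inside_not_cut: "e \<in> inside S \<or> e \<in> inside (- S) \<Longrightarrow> e \<noteq> e2"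
  using crossing by (auto simp: inside_def)

lemma energy_contract:
  "energy \<beta> g f = side_energy S (g \<circ> glue) (f \<circ> glue) + side_energy (- S) (g \<circ> glue) (f \<circ> glue) +
    (g (glue b2) - g a2) * (f (glue b2) - f a2) / (L1 + L2)"
proof -
  have "energy \<beta> g f = (\<Sum>e\<in>edge_set \<beta>.
      ((g \<circ> glue) (tgt e) - (g \<circ> glue) (src e)) * ((f \<circ> glue) (tgt e) - (f \<circ> glue) (src e)) / len \<beta> e)"
    by (simp add: energy_def \<beta>_simps)
  also have "\<dots> = side_energy S (g \<circ> glue) (f \<circ> glue) + side_energy (- S) (g \<circ> glue) (f \<circ> glue) +
      ((g \<circ> glue) b2 - (g \<circ> glue) a2) * ((f \<circ> glue) b2 - (f \<circ> glue) a2) / (L1 + L2)"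
    unfolding sum_edges_contract cut_end_product side_energy_def
    using inside_not_cut by (simp add: \<beta>_simps cong: sum.cong)
  finally show ?thesis by simp
qed

text \<open>
  A potential whose two poles lie on the same side drives opposite currents through the two cut
  edges, so shifting it by a constant on one side makes it a potential on the contraction.
\<close>

definition shift :: "('v \<Rightarrow> real) \<Rightarrow> 'v \<Rightarrow> real" where
  "shift f v = f v + of_bool (v \<in> S) * (f a1 - f b1)"

lemma shift_glue [simp]: "shift f (glue v) = shift f v"
  by (cases "v = b1") (simp_all add: shift_def)

lemma potential_shift:
  assumes f: "potential \<Gamma> x y f" and side: "x \<in> S \<longleftrightarrow> y \<in> S"
  shows "potential \<beta> (glue x) (glue y) (shift f)"
  unfolding potential_def
proof
  fix g :: "'v \<Rightarrow> real"
  let ?g = "g \<circ> glue"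
  have cur: "current1 f = - current2 f"
    using current_sum[OF f] side by simp
  then have "f a1 - f b1 = L1 * current2 f" "f b2 - f a2 = L2 * current2 f"
    using cut_lengths by (auto simp: current1_def current2_def field_simps)
  \<comment> \<open>The currents through the cut edges are opposite, so the shift adds the drop
    along \<open>e1\<close> to that along \<open>e2\<close>. The lengthened edge thus carries the
    old current of \<open>e2\<close>.\<close>
  then have drop: "(shift f b2 - shift f a2) / (L1 + L2) = current2 f"
    using cut_lengths by (simp add: shift_def field_simps)
  have side_shift: "side_energy X ?g (shift f) = side_energy X ?g f" if "X = S \<or> X = - S" for X
    unfolding side_energy_def using that by (intro sum.cong) (auto simp: shift_def inside_def)
  have "shift f \<circ> glue = shift f"
    by (simp add: fun_eq_iff)
  then have "energy \<beta> g (shift f) = side_energy S ?g f + side_energy (- S) ?g f +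
      (?g b2 - ?g a2) * current2 f"
    unfolding energy_contract using side_shift by (simp flip: drop)
  also have "\<dots> = energy \<Gamma> ?g f"
    unfolding energy_split by simp
  also have "\<dots> = g (glue x) - g (glue y)"
    using f unfolding potential_def by simp
  finally show "energy \<beta> g (shift f) = g (glue x) - g (glue y)" .
qed

lemma resistance_same_side:
  assumes xy: "x \<in> V" "y \<in> V" and side: "x \<in> S \<longleftrightarrow> y \<in> S"
  shows "network_resistance \<beta> (glue x) (glue y) = R x y"
proof -
  obtain f where f: "potential \<Gamma> x y f"
    using potential_exists[OF metrized_graph xy] by blast
  have "network_resistance \<beta> (glue x) (glue y) = shift f (glue x) - shift f (glue y)"
    using xy glue_in_contract potential_shift[OF f side]
    by (intro network_resistance_eq fin_digraph_contract)
  also have "\<dots> = R x y"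
    using network_resistance_eq[OF fin_digraph xy f] side by (simp, simp add: shift_def)
  finally show ?thesis .
qed

text \<open>\<open>b2\<close> and \<open>a2\<close> lie on different sides, so
  \<open>potential_shift\<close> does not apply to them directly. The current is routed through the
  merged vertex, as a superposition of one from \<open>b2\<close> to \<open>b1\<close> and one from
  \<open>a1\<close> to \<open>a2\<close>.\<close>

lemma resistance_glued_edge:
  assumes \<phi>: "potential \<Gamma> b1 a1 \<phi>"
  shows "network_resistance \<beta> (glue b2) a2 = (L1 + L2) * (\<phi> b1 - \<phi> b2 + (\<phi> a2 - \<phi> a1)) / L1"
proof -
  obtain \<psi> \<omega> where \<psi>: "potential \<Gamma> b2 b1 \<psi>" and \<omega>: "potential \<Gamma> a1 a2 \<omega>"
    using potential_exists[OF metrized_graph] cut_ends by blast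
  have "potential \<beta> (glue b2) a1 (shift \<psi>)" "potential \<beta> a1 a2 (shift \<omega>)"
    using potential_shift[OF \<psi>] potential_shift[OF \<omega>] by simp_all
  from potential_add[OF this]
  have "network_resistance \<beta> (glue b2) a2 =
      (shift \<psi> (glue b2) + shift \<omega> (glue b2)) - (shift \<psi> a2 + shift \<omega> a2)"
    using glue_in_contract[of b2] glue_in_contract[of a2]
    by (intro network_resistance_eq fin_digraph_contract) auto
  then have eq: "network_resistance \<beta> (glue b2) a2 =
      (\<psi> b2 - \<psi> a2 - (\<psi> b1 - \<psi> a1)) + (\<omega> b2 - \<omega> a2 - (\<omega> b1 - \<omega> a1))"
    unfolding shift_glue by (simp add: shift_def)
  have "f b2 - f a2 = - (f b1 - f a1) * L2 / L1"
    if "current1 f = - current2 f" for f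
    using that cut_lengths by (simp add: current1_def current2_def field_simps)
  then have drop: "f b2 - f a2 - (f b1 - f a1) = - ((f b1 - f a1) * (L1 + L2) / L1)"
    if "current1 f = - current2 f" for f
    using that cut_lengths by (simp add: field_simps)
  have cur: "current1 \<psi> = - current2 \<psi>" "current1 \<omega> = - current2 \<omega>"
    using current_sum[OF \<psi>] current_sum[OF \<omega>] by simp_all
  have jump: "\<psi> b1 - \<psi> a1 = \<phi> b2 - \<phi> b1" "\<omega> b1 - \<omega> a1 = \<phi> a1 - \<phi> a2"
    using reciprocity[OF \<psi> \<phi>] reciprocity[OF \<omega> \<phi>] by simp_all
  have "network_resistance \<beta> (glue b2) a2 =
      - ((\<phi> b2 - \<phi> b1) * (L1 + L2) / L1) + - ((\<phi> a1 - \<phi> a2) * (L1 + L2) / L1)"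
    unfolding eq drop[OF cur(1)] drop[OF cur(2)] unfolding jump ..
  also have "\<dots> = (L1 + L2) * (\<phi> b1 - \<phi> b2 + (\<phi> a2 - \<phi> a1)) / L1"
    using cut_lengths by (simp add: field_simps)
  finally show ?thesis .
qed

end

section \<open>Comparing tau before and after contraction\<close>

context two_edge_cut
begin

lemma R_commute: "x \<in> V \<Longrightarrow> y \<in> V \<Longrightarrow> R x y = R y x"
  by (rule network_resistance_commute[OF metrized_graph])

lemma R_refl: "x \<in> V \<Longrightarrow> R x x = 0"
  using potential_exists[OF metrized_graph, of x x] network_resistance_eq[OF fin_digraph, of x x]
  by auto

text \<open>By \<open>resistance_same_side\<close> these terms occur unchanged in the formula for
  the contraction.\<close>

definition side_defect :: "'v set \<Rightarrow> real" where
  "side_defect X = (\<Sum>e\<in>inside X. (len \<Gamma> e - R (src e) (tgt e))\<^sup>2 / (3 * len \<Gamma> e))"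

lemma tau_split:
  "4 * tau \<Gamma> = side_defect S + side_defect (- S) +
    side_energy S (\<lambda>v. R v a1) (\<lambda>v. R v a1) + side_energy (- S) (\<lambda>v. R v a1) (\<lambda>v. R v a1) +
    ((L1 - R b1 a1)\<^sup>2 / (3 * L1) + (R b1 a1)\<^sup>2 / L1) +
    ((L2 - R b2 a2)\<^sup>2 / (3 * L2) + (R b2 a1 - R a2 a1)\<^sup>2 / L2)"
proof -
  have "R (src e1) (tgt e1) = R b1 a1" "R (src e2) (tgt e2) = R b2 a2"
    using crossing R_commute cut_edges by (auto simp: cut_end_def)
  moreover have "(R (tgt e1) a1 - R (src e1) a1)\<^sup>2 = (R b1 a1)\<^sup>2"
    "(R (tgt e2) a1 - R (src e2) a1)\<^sup>2 = (R b2 a1 - R a2 a1)\<^sup>2"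
    using cut_end_product[of "\<lambda>v. R v a1" "\<lambda>v. R v a1"] R_refl[OF cut_ends(1)]
    by (simp_all add: power2_eq_square)
  moreover have "(\<Sum>e\<in>inside X. (len \<Gamma> e - R (src e) (tgt e))\<^sup>2 / (3 * len \<Gamma> e) +
      (R (tgt e) a1 - R (src e) a1)\<^sup>2 / len \<Gamma> e) =
      side_defect X + side_energy X (\<lambda>v. R v a1) (\<lambda>v. R v a1)" for X
    by (simp add: side_defect_def side_energy_def sum.distrib power2_eq_square)
  ultimately show ?thesis
    unfolding tau_eq[OF metrized_graph cut_ends(1)] sum_edges by simp
qed

text \<open>The base point is the merged vertex, which is \<open>b1\<close> as seen from
  \<open>S\<close> and \<open>a1\<close> as seen from the other side. Compared with
  \<open>tau_split\<close>, only the energy on \<open>S\<close> changes its base point; the rest of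
  the change sits on \<open>e1\<close> and \<open>e2\<close>.\<close>

lemma tau_contract_split:
  defines "r \<equiv> network_resistance \<beta> (glue b2) a2"
  shows "4 * tau \<beta> = side_defect S + side_defect (- S) +
    side_energy S (\<lambda>v. R v b1) (\<lambda>v. R v b1) + side_energy (- S) (\<lambda>v. R v a1) (\<lambda>v. R v a1) +
    ((L1 + L2 - r)\<^sup>2 / (3 * (L1 + L2)) + (R b2 b1 - R a2 a1)\<^sup>2 / (L1 + L2))"
proof -
  let ?R = "network_resistance \<beta>"
  have a1: "a1 \<in> vertex_set \<beta>"
    using glue_in_contract[of b1] by simp
  have base_b: "?R (glue v) a1 = R v b1" if "v \<in> V" "v \<in> S" for v
    using resistance_same_side[of v b1] that by simp
  have base_a: "?R (glue v) a1 = R v a1" if "v \<in> V" "v \<notin> S" for v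
    using resistance_same_side[of v a1] that by simp
  define h where "h e = (len \<beta> e - ?R (glue (src e)) (glue (tgt e)))\<^sup>2 / (3 * len \<beta> e) +
    (?R (glue (tgt e)) a1 - ?R (glue (src e)) a1)\<^sup>2 / len \<beta> e" for e
  have "4 * tau \<beta> = (\<Sum>e\<in>edge_set \<beta>. h e)"
    unfolding tau_eq[OF metrized_graph_contract a1] h_def by (simp add: \<beta>_simps(3,4))
  also have "\<dots> = (\<Sum>e\<in>inside S. h e) + (\<Sum>e\<in>inside (- S). h e) + h e2"
    by (rule sum_edges_contract)
  also have "(\<Sum>e\<in>inside S. h e) = side_defect S + side_energy S (\<lambda>v. R v b1) (\<lambda>v. R v b1)"
    unfolding side_defect_def side_energy_def sum.distrib[symmetric]
  proof (rule sum.cong[OF refl])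
    fix e
    assume e: "e \<in> inside S"
    then have "e \<noteq> e2" using inside_not_cut by blast
    then show "h e = (len \<Gamma> e - R (src e) (tgt e))\<^sup>2 / (3 * len \<Gamma> e) +
        (R (tgt e) b1 - R (src e) b1) * (R (tgt e) b1 - R (src e) b1) / len \<Gamma> e"
      using e resistance_same_side[of "src e" "tgt e"] base_b[of "src e"] base_b[of "tgt e"]
      by (simp add: h_def \<beta>_simps(5) inside_def power2_eq_square)
  qed
  also have "(\<Sum>e\<in>inside (- S). h e) = side_defect (- S) + side_energy (- S) (\<lambda>v. R v a1) (\<lambda>v. R v a1)"
    unfolding side_defect_def side_energy_def sum.distrib[symmetric]
  proof (rule sum.cong[OF refl])
    fix e
    assume e: "e \<in> inside (- S)"
    then have "e \<noteq> e2" using inside_not_cut by blast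
    then show "h e = (len \<Gamma> e - R (src e) (tgt e))\<^sup>2 / (3 * len \<Gamma> e) +
        (R (tgt e) a1 - R (src e) a1) * (R (tgt e) a1 - R (src e) a1) / len \<Gamma> e"
      using e resistance_same_side[of "src e" "tgt e"] base_a[of "src e"] base_a[of "tgt e"]
      by (simp add: h_def \<beta>_simps(5) inside_def power2_eq_square)
  qed
  also have "h e2 = (L1 + L2 - r)\<^sup>2 / (3 * (L1 + L2)) + (R b2 b1 - R a2 a1)\<^sup>2 / (L1 + L2)"
  proof -
    have "?R (glue b2) (glue a2) = ?R (glue a2) (glue b2)"
      by (intro network_resistance_commute[OF metrized_graph_contract] glue_in_contract cut_ends)
    then have "?R (glue (src e2)) (glue (tgt e2)) = r"
      using crossing unfolding r_def by (auto simp: cut_end_def)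
    moreover have "(?R (glue (tgt e2)) a1 - ?R (glue (src e2)) a1)\<^sup>2 = (?R (glue b2) a1 - ?R (glue a2) a1)\<^sup>2"
      using cut_end_product(2)[of "\<lambda>v. ?R (glue v) a1" "\<lambda>v. ?R (glue v) a1"]
      by (simp only: power2_eq_square)
    moreover have "?R (glue b2) a1 = R b2 b1" "?R (glue a2) a1 = R a2 a1"
      using base_b[of b2] base_a[of a2] by simp_all
    ultimately show ?thesis
      by (simp only: h_def \<beta>_simps(5) refl if_True)
  qed
  finally show ?thesis by simp
qed

lemma tau_contract: "tau \<beta> = tau \<Gamma>"
proof -
  \<comment> \<open>The same cut seen from the other side, with \<open>a1\<close>, \<open>a2\<close>
    and \<open>b1\<close>, \<open>b2\<close> exchanged.\<close>
  interpret C: two_edge_cut \<Gamma> "- S" e1 e2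
    rewrites "- (- S) = S"
    by (rule compl) simp
  obtain \<phi> where \<phi>: "potential \<Gamma> b1 a1 \<phi>"
    using potential_exists[OF metrized_graph] cut_ends by blast
  \<comment> \<open>A current \<open>c\<close> runs around the long way through \<open>S\<close>,
    \<open>e2\<close> and the other side; dividing voltages by it gives the resistances
    \<open>x\<close> and \<open>y\<close>. The drop along \<open>e1\<close> is (1 - c) L1, which
    makes L1 / c the whole circumference.\<close>
  define c where "c = current2 \<phi>"
  define D where "D = L1 / c"
  define x where "x = (\<phi> b1 - \<phi> b2) / c"
  define y where "y = (\<phi> a2 - \<phi> a1) / c"
  have "c \<noteq> 0"
    using current2_nonzero[OF \<phi>] by (simp add: c_def)
  have D: "D \<noteq> 0" and c: "c = L1 / D"
    using \<open>c \<noteq> 0\<close> cut_lengths by (simp_all add: D_def)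
  have m: "\<phi> b1 - \<phi> b2 = x * L1 / D" and n: "\<phi> a2 - \<phi> a1 = y * L1 / D"
    using \<open>c \<noteq> 0\<close> D cut_lengths by (simp_all add: x_def y_def c)
  have cur1: "\<phi> b1 - \<phi> a1 = (1 - c) * L1" and cur2: "\<phi> b2 - \<phi> a2 = c * L2"
    using current1_\<phi>[OF \<phi>] cut_lengths by (simp_all add: c_def current1_def current2_def field_simps)
  \<comment> \<open>The drop around the long way equals the drop along \<open>e1\<close>.\<close>
  have "x * L1 / D + y * L1 / D + L1 / D * L2 = (1 - L1 / D) * L1"
    using m n cur1 cur2 c by simp
  then have "L1 * D = L1 * (L1 + L2 + x + y)"
    using D by (simp add: field_simps)
  then have D_eq: "D = L1 + L2 + x + y"
    using cut_lengths by simp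
  \<comment> \<open>An arc \<open>z\<close> of the circle lies in parallel with the remaining
    \<open>D - z\<close>.\<close>
  have cancel: "r = z * (D - z) / D" if "r * (L1 / D) = z * L1 / D * (1 - z * L1 / D / L1)" for r z
  proof -
    have "L1 * (r * D) = L1 * (z * (D - z))"
      using that D cut_lengths by (simp add: field_simps)
    then have "r * D = z * (D - z)"
      using cut_lengths by simp
    then show ?thesis
      using D by (simp add: eq_divide_eq)
  qed
  have Rb: "R b1 b2 = x * (D - x) / D"
  proof -
    have "R b1 b2 * (L1 / D) = x * L1 / D * (1 - x * L1 / D / L1)"
      using side_resistance[OF \<phi>] unfolding m c_def[symmetric] c .
    then show ?thesis by (rule cancel)
  qed
  have Ra: "R a1 a2 = y * (D - y) / D"
  proof -
    \<comment> \<open>From the other side the poles are exchanged; the current through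
      \<open>e2\<close> remains \<open>c\<close>, because sign and direction both flip.\<close>
    have neg: "potential \<Gamma> a1 b1 (\<lambda>v. - \<phi> v)"
      by (rule potential_minus[OF \<phi>])
    have "C.current2 (\<lambda>v. - \<phi> v) = L1 / D"
      using c by (simp add: C.current2_def c_def current2_def algebra_simps)
    then have "R a1 a2 * (L1 / D) = (\<phi> a2 - \<phi> a1) * (1 - (\<phi> a2 - \<phi> a1) / L1)"
      using C.side_resistance[OF neg] by simp
    then have "R a1 a2 * (L1 / D) = y * L1 / D * (1 - y * L1 / D / L1)"
      unfolding n .
    then show ?thesis by (rule cancel)
  qed
  have R1: "R b1 a1 = L1 * (D - L1) / D" and R1': "L1 - R b1 a1 = L1\<^sup>2 / D"
    using resistance_e1[OF \<phi>] D c unfolding c_def[symmetric]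
    by (simp_all add: field_simps power2_eq_square)
  have R2: "L2 - R b2 a2 = L2\<^sup>2 / D"
    using resistance_e2[OF \<phi>] D c cut_lengths unfolding c_def[symmetric]
    by (simp add: field_simps power2_eq_square)
  have R3: "L1 + L2 - network_resistance \<beta> (glue b2) a2 = (L1 + L2)\<^sup>2 / D"
  proof -
    have "network_resistance \<beta> (glue b2) a2 = (L1 + L2) * (x + y) / D"
      using cut_lengths D unfolding resistance_glued_edge[OF \<phi>] m n by (simp add: field_simps)
    also have "x + y = D - (L1 + L2)"
      by (simp add: D_eq)
    finally have "network_resistance \<beta> (glue b2) a2 = (L1 + L2) * (D - (L1 + L2)) / D" .
    then show ?thesis
      using D by (simp add: field_simps power2_eq_square)
  qed
  have base: "R v a1 = R v b1 + 2 * \<phi> v - \<phi> a1 - \<phi> b1" if "v \<in> V" for v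
    by (rule network_resistance_change_base[OF metrized_graph that _ _ \<phi>]) simp_all
  have diff: "R b2 a1 - R a2 a1 = L2 * (L1 + x - y) / D"
  proof -
    have "R b2 a1 = R b1 b2 - 2 * (\<phi> b1 - \<phi> b2) + (\<phi> b1 - \<phi> a1)"
      using base[of b2] R_commute[of b1 b2] by simp
    then have "R b2 a1 - R a2 a1 = x * (D - x) / D - 2 * (x * L1 / D) + (1 - L1 / D) * L1 - y * (D - y) / D"
      using R_commute[of a1 a2] by (simp add: m cur1 c Rb Ra)
    also have "\<dots> = (x * (D - x) - 2 * x * L1 + (D - L1) * L1 - y * (D - y)) / D"
      using D by (simp add: field_simps)
    also have "x * (D - x) - 2 * x * L1 + (D - L1) * L1 - y * (D - y) = L2 * (L1 + x - y)"
      by (simp add: D_eq algebra_simps)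
    finally show ?thesis .
  qed
  have diff': "R b2 b1 - R a2 a1 = (L1 + L2) * (x - y) / D"
  proof -
    have "R b2 b1 - R a2 a1 = (x * (D - x) - y * (D - y)) / D"
      using R_commute[of a1 a2] R_commute[of b1 b2] by (simp add: Ra Rb diff_divide_distrib)
    also have "x * (D - x) - y * (D - y) = (L1 + L2) * (x - y)"
      by (simp add: D_eq algebra_simps)
    finally show ?thesis .
  qed
  \<comment> \<open>By \<open>base\<close> the two resistance functions differ by
    \<open>2 * \<phi>\<close> plus a constant. Expanding the square leaves a cross term and the
    energy of \<open>\<phi>\<close>, and \<open>side_energy_\<phi>\<close> evaluates both.\<close>
  have side: "side_energy S (\<lambda>v. R v a1) (\<lambda>v. R v a1) =
      side_energy S (\<lambda>v. R v b1) (\<lambda>v. R v b1) - 4 * L1 * x * (L2 + y) / D\<^sup>2"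
  proof -
    have "side_energy S (\<lambda>v. R v a1) (\<lambda>v. R v a1) =
        side_energy S (\<lambda>v. R v b1) (\<lambda>v. R v b1) +
        4 * side_energy S (\<lambda>v. R v b1) \<phi> + 4 * side_energy S \<phi> \<phi>"
      unfolding side_energy_def sum_distrib_left sum.distrib[symmetric]
    proof (rule sum.cong[OF refl])
      fix e
      assume "e \<in> inside S"
      then have e: "src e \<in> V" "tgt e \<in> V" "len \<Gamma> e \<noteq> 0"
        using len_pos[of e] by (auto simp: inside_def)
      show "(R (tgt e) a1 - R (src e) a1) * (R (tgt e) a1 - R (src e) a1) / len \<Gamma> e =
        (R (tgt e) b1 - R (src e) b1) * (R (tgt e) b1 - R (src e) b1) / len \<Gamma> e +
        4 * ((R (tgt e) b1 - R (src e) b1) * (\<phi> (tgt e) - \<phi> (src e)) / len \<Gamma> e) +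
        4 * ((\<phi> (tgt e) - \<phi> (src e)) * (\<phi> (tgt e) - \<phi> (src e)) / len \<Gamma> e)"
        unfolding base[OF e(1)] base[OF e(2)] using e(3) by (simp add: field_simps)
    qed
    also have "\<dots> = side_energy S (\<lambda>v. R v b1) (\<lambda>v. R v b1) +
        4 * (L1 / D * (x * L1 / D - x * (D - x) / D))"
      using R_refl[of b1] R_commute[of b1 b2]
      by (simp add: side_energy_\<phi>[OF \<phi>] c_def[symmetric] c m Rb algebra_simps)
    also have "4 * (L1 / D * (x * L1 / D - x * (D - x) / D)) = 4 * L1 * x * (L1 - (D - x)) / D\<^sup>2"
      using D by (simp add: field_simps power2_eq_square)
    also have "L1 - (D - x) = - (L2 + y)"
      by (simp add: D_eq)
    finally show ?thesis
      by (simp only: mult_minus_right minus_divide_left[symmetric] diff_conv_add_uminus)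
  qed
  show ?thesis
    using contraction_identity[OF cut_lengths D D_eq] tau_split tau_contract_split
    unfolding side R1' R2 R3 diff diff' unfolding R1 by simp
qed

end

section \<open>Reduction to edge connectivity three\<close>

text \<open>Deleting \<open>F\<close> disconnects exactly when \<open>F\<close> contains a cut, so
  the cuts alone determine the infimum. Stated as a lower bound, this includes the graph with one
  vertex, where the right side is vacuous and the connectivity infinite.\<close>

lemma le_edge_connectivity_iff:
  assumes "fin_digraph (skeleton \<Gamma>)" "vertex_set \<Gamma> \<noteq> {}"
  shows "enat k \<le> edge_connectivity \<Gamma> \<longleftrightarrow>
    (\<forall>S\<subseteq>vertex_set \<Gamma>. S \<noteq> {} \<longrightarrow> S \<noteq> vertex_set \<Gamma> \<longrightarrow> k \<le> card (cut_arcs (skeleton \<Gamma>) S))"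
proof -
  interpret fin_digraph "skeleton \<Gamma>" by fact
  let ?G = "\<lambda>F. (skeleton \<Gamma>)\<lparr>arcs := edge_set \<Gamma> - F\<rparr>"
  have wf: "wf_digraph (?G F)" for F
    by unfold_locales auto
  have cut: "cut_arcs (?G F) S = cut_arcs (skeleton \<Gamma>) S - F" for F S
    by (auto simp: cut_arcs_def)
  have disconnected: "\<not> Digraph_Component.connected (?G F) \<longleftrightarrow>
      (\<exists>S\<subseteq>vertex_set \<Gamma>. S \<noteq> {} \<and> S \<noteq> vertex_set \<Gamma> \<and> cut_arcs (skeleton \<Gamma>) S \<subseteq> F)" for F
    unfolding connected_iff_cut[OF wf] using assms(2) by (auto simp: cut)
  have sub: "cut_arcs (skeleton \<Gamma>) S \<subseteq> edge_set \<Gamma>" for S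
    by (auto simp: cut_arcs_def)
  have "edge_connectivity \<Gamma> =
      (INF F\<in>{F. F \<subseteq> edge_set \<Gamma> \<and> \<not> Digraph_Component.connected (?G F)}. enat (card F))"
    unfolding edge_connectivity_def by (intro arg_cong[of _ _ Inf]) auto
  then have "enat k \<le> edge_connectivity \<Gamma> \<longleftrightarrow>
      (\<forall>F\<subseteq>edge_set \<Gamma>. \<not> Digraph_Component.connected (?G F) \<longrightarrow> k \<le> card F)"
    by (auto simp: le_INF_iff)
  also have "\<dots> \<longleftrightarrow>
      (\<forall>S\<subseteq>vertex_set \<Gamma>. S \<noteq> {} \<longrightarrow> S \<noteq> vertex_set \<Gamma> \<longrightarrow> k \<le> card (cut_arcs (skeleton \<Gamma>) S))"
    unfolding disconnected
  proof (intro iffI allI impI)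
    fix F
    assume *: "\<forall>S\<subseteq>vertex_set \<Gamma>. S \<noteq> {} \<longrightarrow> S \<noteq> vertex_set \<Gamma> \<longrightarrow> k \<le> card (cut_arcs (skeleton \<Gamma>) S)"
      and F: "F \<subseteq> edge_set \<Gamma>"
      and "\<exists>S\<subseteq>vertex_set \<Gamma>. S \<noteq> {} \<and> S \<noteq> vertex_set \<Gamma> \<and> cut_arcs (skeleton \<Gamma>) S \<subseteq> F"
    then obtain S where "k \<le> card (cut_arcs (skeleton \<Gamma>) S)" "cut_arcs (skeleton \<Gamma>) S \<subseteq> F"
      by blast
    then show "k \<le> card F"
      using card_mono[OF finite_subset[OF F finite_arcs]] le_trans by blast
  qed (use sub in blast)
  finally show ?thesis .
qed

text \<open>The hypothesis is a lower bound instead of an equality because a contraction can raise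
  the connectivity, even to infinity when a single vertex with loops remains.\<close>

lemma exists_three_edge_connected:
  fixes \<Gamma> :: "('v, 'e) metrized"
  assumes "metrized_graph \<Gamma>" "2 \<le> edge_connectivity \<Gamma>"
  shows "\<exists>\<beta> :: ('v, 'e) metrized.
    metrized_graph \<beta> \<and> tau \<Gamma> = tau \<beta> \<and> edge_connectivity \<beta> \<ge> 3 \<and>
    card (edge_set \<Gamma>) \<ge> card (edge_set \<beta>) \<and> genus \<Gamma> = genus \<beta>"
  using assms
proof (induction "card (edge_set \<Gamma>)" arbitrary: \<Gamma> rule: less_induct)
  case less
  have nonempty: "vertex_set N \<noteq> {}" if "metrized_graph N" for N :: "('v, 'e) metrized"
    using that by (auto simp: metrized_graph_def fin_digraph_def connected_iff_cut)
  note le_iff = le_edge_connectivity_iff[OF _ nonempty]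
  have fin: "fin_digraph (skeleton \<Gamma>)"
    using less.prems by (simp add: metrized_graph_def)
  then interpret fin_digraph "skeleton \<Gamma>" .
  show ?case
  proof (cases "edge_connectivity \<Gamma> \<ge> 3")
    case True
    then show ?thesis using less.prems by blast
  next
    case False
    have two: "2 \<le> card (cut_arcs (skeleton \<Gamma>) T)"
      if "T \<subseteq> vertex_set \<Gamma>" "T \<noteq> {}" "T \<noteq> vertex_set \<Gamma>" for T
      using less.prems(2) that le_iff[OF fin less.prems(1), of 2] by (auto simp: numeral_eq_enat)
    obtain S where S: "S \<subseteq> vertex_set \<Gamma>" "S \<noteq> {}" "S \<noteq> vertex_set \<Gamma>"
      "\<not> 3 \<le> card (cut_arcs (skeleton \<Gamma>) S)"
      using False le_iff[OF fin less.prems(1), of 3] by (auto simp: numeral_eq_enat)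
    then have "card (cut_arcs (skeleton \<Gamma>) S) = 2"
      using two[of S] by simp
    then obtain e1 e2 where "cut_arcs (skeleton \<Gamma>) S = {e1, e2}" "e1 \<noteq> e2"
      by (auto simp: card_2_iff)
    then interpret two_edge_cut \<Gamma> S e1 e2
      using less.prems(1) two by unfold_locales auto
    have card: "card (edge_set \<Gamma>) = Suc (card (edge_set \<beta>))" "card (vertex_set \<Gamma>) = Suc (card (vertex_set \<beta>))"
      using cut_edges(1) cut_ends(3) card.remove[of E e1] card.remove[of V b1]
      by (simp_all add: \<beta>_simps)
    have "2 \<le> card (cut_arcs (skeleton \<beta>) T)"
      if T: "T \<subseteq> vertex_set \<beta>" "T \<noteq> {}" "T \<noteq> vertex_set \<beta>" for T
      using cut_contract[OF T] two by metis
    then have "2 \<le> edge_connectivity \<beta>"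
      using le_iff[OF fin_digraph_contract metrized_graph_contract, of 2] by (auto simp: numeral_eq_enat)
    with less.hyps[OF _ metrized_graph_contract] card(1)
    obtain \<beta>' :: "('v, 'e) metrized" where "metrized_graph \<beta>'" "tau \<beta> = tau \<beta>'" "edge_connectivity \<beta>' \<ge> 3"
      "card (edge_set \<beta>) \<ge> card (edge_set \<beta>')" "genus \<beta> = genus \<beta>'"
      by auto
    moreover have "genus \<Gamma> = genus \<beta>"
      using card by (simp add: genus_def)
    ultimately show ?thesis
      using tau_contract card(1) by (intro exI[of _ \<beta>']) auto
  qed
qed

theorem theorem7p4:
  fixes \<Gamma> :: "('v, 'e) metrized"
  assumes "metrized_graph \<Gamma>"
    and "edge_connectivity \<Gamma> = 2"
  shows "\<exists>\<beta> :: ('v, 'e) metrized.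
           metrized_graph \<beta> \<and>
           tau \<Gamma> = tau \<beta> \<and>
           edge_connectivity \<beta> \<ge> 3 \<and>
           card (edge_set \<Gamma>) \<ge> card (edge_set \<beta>) \<and>
           genus \<Gamma> = genus \<beta>"
  using exists_three_edge_connected[OF assms(1)] assms(2) by simp

end
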